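(* Let $A=\mathrm{Free}(k)$ be a free MV-algebra over $k$ generators ($k$ a cardinal, possibly infinite). Then $\mathrm{Spec}(A)$ is spectral. Moreover, there is a lattice anti-isomorphism between the lattice $\overset{\circ}{K}(\mathrm{Spec}(A))$ of the compact open subsets of $\mathrm{Spec}(A)$ and the lattice of the cylinder rational polyhedra of $[0,1]^k$.
   Context: An MV-algebra is a structure $(A,\oplus,0,\neg)$ such that $(A,\oplus,0)$ is a commutative monoid, $\neg\neg x=x$, $x\oplus\neg 0=\neg 0$ and $\neg(\neg x\oplus y)\oplus y=\neg(\neg y\oplus x)\oplus x$. It is a lattice with $x\vee y=\neg(\neg x\oplus y)\oplus y$ and $x\wedge y=\neg(\neg x\vee\neg y)$. An ideal is a nonempty downward closed subset closed under $\oplus$; an ideal $P\neq A$ is prime if $x\wedge y\in P$ implies $x\in P$ or $y\in P$. $\mathrm{Spec}(A)$ is the set of prime ideals with the Zariski topology generated by the open sets $O(a)=\{P : a\notin P\}$, $a\in A$. $\mathrm{Free}(k)$ is the MV-algebra of McNaughton functions $[0,1]^k\to[0,1]$ (continuous piecewise linear functions with integer coefficients, each depending on finitely many variables). A topological space is spectral if it is sober (every irreducible closed set is the closure of a unique singleton), compact, and its compact open subsets form a basis of the topology closed under intersections of any two members. For a finite set $Y$, a rational simplex in $[0,1]^Y$ is the convex envelope of finitely many affinely independent rational points, and a rational polyhedron is a finite union of rational simplexes. For an arbitrary set $X$, a cylinder rational polyhedron of $[0,1]^X$ is a set $\{f\in[0,1]^X : f|_Y\in P_0\}$ where $Y\subseteq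 X$ is finite and $P_0\subseteq[0,1]^Y$ is a rational polyhedron. Lattices of sets are ordered by inclusion. *)

theory Defs
  imports "HOL-Analysis.Analysis" "HOL-Algebra.Group"
begin

section \<open>MV-algebras and their prime spectrum\<close>

record 'a mv_algebra = "'a partial_object" +
  mv_add :: "'a \<Rightarrow> 'a \<Rightarrow> 'a"
  mv_zero :: 'a
  mv_neg :: "'a \<Rightarrow> 'a"

locale mv_algebra =
  fixes A :: "('a, 'm) mv_algebra_scheme"
  assumes comm_monoid_add:
      "comm_monoid \<lparr>carrier = carrier A, mult = mv_add A, one = mv_zero A\<rparr>"
    and neg_closed: "x \<in> carrier A \<Longrightarrow> mv_neg A x \<in> carrier A"
    and neg_neg: "x \<in> carrier A \<Longrightarrow> mv_neg A (mv_neg A x) = x"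
    and add_neg_zero: "x \<in> carrier A \<Longrightarrow> mv_add A x (mv_neg A (mv_zero A)) = mv_neg A (mv_zero A)"
    and mv_axiom: "\<lbrakk>x \<in> carrier A; y \<in> carrier A\<rbrakk> \<Longrightarrow>
        mv_add A (mv_neg A (mv_add A (mv_neg A x) y)) y =
        mv_add A (mv_neg A (mv_add A (mv_neg A y) x)) x"

definition mv_sup :: "('a, 'm) mv_algebra_scheme \<Rightarrow> 'a \<Rightarrow> 'a \<Rightarrow> 'a" where
  "mv_sup A x y = mv_add A (mv_neg A (mv_add A (mv_neg A x) y)) y"

definition mv_inf :: "('a, 'm) mv_algebra_scheme \<Rightarrow> 'a \<Rightarrow> 'a \<Rightarrow> 'a" where
  "mv_inf A x y = mv_neg A (mv_sup A (mv_neg A x) (mv_neg A y))"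

definition mv_le :: "('a, 'm) mv_algebra_scheme \<Rightarrow> 'a \<Rightarrow> 'a \<Rightarrow> bool" where
  "mv_le A x y \<longleftrightarrow> mv_sup A x y = y"

definition mv_ideal :: "('a, 'm) mv_algebra_scheme \<Rightarrow> 'a set \<Rightarrow> bool" where
  "mv_ideal A I \<longleftrightarrow>
     I \<subseteq> carrier A \<and> I \<noteq> {} \<and>
     (\<forall>x\<in>carrier A. \<forall>y\<in>I. mv_le A x y \<longrightarrow> x \<in> I) \<and>
     (\<forall>x\<in>I. \<forall>y\<in>I. mv_add A x y \<in> I)"

definition mv_prime_ideal :: "('a, 'm) mv_algebra_scheme \<Rightarrow> 'a set \<Rightarrow> bool" where
  "mv_prime_ideal A P \<longleftrightarrow>
     mv_ideal A P \<and> P \<noteq> carrier A \<and>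
     (\<forall>x\<in>carrier A. \<forall>y\<in>carrier A. mv_inf A x y \<in> P \<longrightarrow> x \<in> P \<or> y \<in> P)"

definition mv_Spec_open :: "('a, 'm) mv_algebra_scheme \<Rightarrow> 'a \<Rightarrow> 'a set set" where
  "mv_Spec_open A a = {P. mv_prime_ideal A P \<and> a \<notin> P}"

definition mv_Spec :: "('a, 'm) mv_algebra_scheme \<Rightarrow> 'a set topology" where
  "mv_Spec A = topology_generated_by (mv_Spec_open A ` carrier A)"

lemma topspace_mv_Spec: "topspace (mv_Spec A) = {P. mv_prime_ideal A P}"
  unfolding mv_Spec_def topology_generated_by_topspace
  by (auto simp: mv_Spec_open_def mv_prime_ideal_def mv_ideal_def)


section \<open>Spectral spaces\<close>

definition irreducible_closedin :: "'a topology \<Rightarrow> 'a set \<Rightarrow> bool" where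
  "irreducible_closedin T C \<longleftrightarrow>
     closedin T C \<and> C \<noteq> {} \<and>
     (\<forall>D E. closedin T D \<and> closedin T E \<and> C = D \<union> E \<longrightarrow> C = D \<or> C = E)"

definition sober_space :: "'a topology \<Rightarrow> bool" where
  "sober_space T \<longleftrightarrow>
     (\<forall>C. irreducible_closedin T C \<longrightarrow> (\<exists>!x. x \<in> topspace T \<and> C = T closure_of {x}))"

definition compact_opens :: "'a topology \<Rightarrow> 'a set set" where
  "compact_opens T = {U. openin T U \<and> compactin T U}"

definition spectral_space :: "'a topology \<Rightarrow> bool" where
  "spectral_space T \<longleftrightarrow>
     sober_space T \<and> compact_space T \<and>
     (\<forall>U. openin T U \<longrightarrow> (\<exists>\<B>\<subseteq>compact_opens T. U = \<Union>\<B>)) \<and>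
     (\<forall>U\<in>compact_opens T. \<forall>V\<in>compact_opens T. U \<inter> V \<in> compact_opens T)"


section \<open>McNaughton functions and free MV-algebras\<close>

text \<open>The cube \<open>[0,1]\<^sup>X\<close>: points are extensional functions, i.e. they take the value
  \<^term>\<open>undefined\<close> off \<open>X\<close>.\<close>

definition cube :: "'k set \<Rightarrow> ('k \<Rightarrow> real) set" where
  "cube X = (X \<rightarrow>\<^sub>E {0..1})"

definition cube_topology :: "'k set \<Rightarrow> ('k \<Rightarrow> real) topology" where
  "cube_topology X = product_topology (\<lambda>_. top_of_set {0..1}) X"

text \<open>McNaughton functions of finitely many variables \<open>Y\<close>: continuous, and at each point
  equal to a member of a fixed finite set of affine forms with integer coefficients; a pair
  \<open>(c, d)\<close> encodes the form with linear coefficients \<open>c\<close> and constant term \<open>d\<close>.\<close>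

definition finite_mcnaughton :: "'k set \<Rightarrow> (('k \<Rightarrow> real) \<Rightarrow> real) \<Rightarrow> bool" where
  "finite_mcnaughton Y g \<longleftrightarrow>
     g \<in> cube Y \<rightarrow> {0..1} \<and>
     continuous_map (cube_topology Y) euclideanreal g \<and>
     (\<exists>F :: (('k \<Rightarrow> int) \<times> int) set. finite F \<and>
        (\<forall>x\<in>cube Y. \<exists>(c, d)\<in>F. g x = (\<Sum>y\<in>Y. of_int (c y) * x y) + of_int d))"

definition mcnaughton :: "'k set \<Rightarrow> (('k \<Rightarrow> real) \<Rightarrow> real) set" where
  "mcnaughton X =
     {f. \<exists>Y g. finite Y \<and> Y \<subseteq> X \<and> finite_mcnaughton Y g \<and>
           f = (\<lambda>x\<in>cube X. g (restrict x Y))}"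

text \<open>The free MV-algebra over the cardinal \<open>|X|\<close>, with the operations
  of the standard MV-algebra \<open>[0,1]\<close> taken pointwise.\<close>

definition free_mv :: "'k set \<Rightarrow> (('k \<Rightarrow> real) \<Rightarrow> real) mv_algebra" where
  "free_mv X =
     \<lparr>carrier = mcnaughton X,
      mv_add = (\<lambda>f g. \<lambda>x\<in>cube X. min 1 (f x + g x)),
      mv_zero = (\<lambda>x\<in>cube X. 0),
      mv_neg = (\<lambda>f. \<lambda>x\<in>cube X. 1 - f x)\<rparr>"

lemma restrict_cube: "x \<in> cube Z \<Longrightarrow> Y \<subseteq> Z \<Longrightarrow> restrict x Y \<in> cube Y"
  by (auto simp: cube_def PiE_def Pi_def extensional_def)

lemma topspace_cube_topology [simp]: "topspace (cube_topology X) = cube X"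
  by (simp add: cube_topology_def cube_def)

lemma continuous_map_cube_restrict:
  assumes "Y \<subseteq> Z"
  shows "continuous_map (cube_topology Z) (cube_topology Y) (\<lambda>x. restrict x Y)"
  unfolding cube_topology_def
  by (rule continuous_map_componentwise[THEN iffD2])
     (use assms in \<open>auto simp: PiE_def Pi_def extensional_def intro!: continuous_map_product_projection\<close>)

lemma finite_mcnaughton_mono:
  assumes "finite_mcnaughton Y g" "Y \<subseteq> Z" "finite Z"
  shows "finite_mcnaughton Z (\<lambda>x. g (restrict x Y))"
proof -
  from assms(1) obtain F :: "(('a \<Rightarrow> int) \<times> int) set" where F: "finite F"
    "\<And>x. x \<in> cube Y \<Longrightarrow> \<exists>(c, d)\<in>F. g x = (\<Sum>y\<in>Y. of_int (c y) * x y) + of_int d"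
    and g: "g \<in> cube Y \<rightarrow> {0..1}" "continuous_map (cube_topology Y) euclideanreal g"
    unfolding finite_mcnaughton_def by blast
  let ?h = "\<lambda>(c :: 'a \<Rightarrow> int, d :: int). (\<lambda>y. if y \<in> Y then c y else 0, d)"
  have "\<exists>(c, d)\<in>?h ` F. g (restrict x Y) = (\<Sum>y\<in>Z. of_int (c y) * x y) + of_int d"
    if x: "x \<in> cube Z" for x
  proof -
    from F(2)[OF restrict_cube[OF x assms(2)]] obtain c d where
      cd: "(c, d) \<in> F" "g (restrict x Y) = (\<Sum>y\<in>Y. of_int (c y) * restrict x Y y) + of_int d"
      by auto
    have "(\<Sum>y\<in>Z. of_int (if y \<in> Y then c y else 0) * x y) = (\<Sum>y\<in>Y. of_int (c y) * restrict x Y y)"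
      by (rule sum.mono_neutral_cong_right) (use assms in auto)
    then show ?thesis
      using cd by (intro bexI[of _ "?h (c, d)"]) auto
  qed
  moreover have "continuous_map (cube_topology Z) euclideanreal (\<lambda>x. g (restrict x Y))"
    using continuous_map_compose[OF continuous_map_cube_restrict[OF assms(2)] g(2)]
    by (simp add: o_def)
  moreover have "(\<lambda>x. g (restrict x Y)) \<in> cube Z \<rightarrow> {0..1}"
    using g(1) restrict_cube[OF _ assms(2)] by blast
  ultimately show ?thesis
    using F(1) unfolding finite_mcnaughton_def by (intro conjI exI[of _ "?h ` F"]) auto
qed

lemma mcnaughton_zero: "(\<lambda>x\<in>cube X. 0) \<in> mcnaughton X"
proof -
  have "finite_mcnaughton {} (\<lambda>x :: 'a \<Rightarrow> real. 0)"
    unfolding finite_mcnaughton_def by (intro conjI exI[of _ "{(\<lambda>_. 0, 0)}"]) auto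
  then show ?thesis
    unfolding mcnaughton_def by (intro CollectI exI[of _ "{}"] exI[of _ "\<lambda>_. 0"]) simp
qed

lemma mcnaughton_neg:
  assumes "f \<in> mcnaughton X"
  shows "(\<lambda>x\<in>cube X. 1 - f x) \<in> mcnaughton X"
proof -
  from assms obtain Y g where Y: "finite Y" "Y \<subseteq> X" and g: "finite_mcnaughton Y g"
    and f: "f = (\<lambda>x\<in>cube X. g (restrict x Y))"
    unfolding mcnaughton_def by blast
  from g obtain F :: "(('a \<Rightarrow> int) \<times> int) set" where F: "finite F"
    "\<And>x. x \<in> cube Y \<Longrightarrow> \<exists>(c, d)\<in>F. g x = (\<Sum>y\<in>Y. of_int (c y) * x y) + of_int d"
    and g': "g \<in> cube Y \<rightarrow> {0..1}" "continuous_map (cube_topology Y) euclideanreal g"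
    unfolding finite_mcnaughton_def by blast
  let ?h = "\<lambda>(c :: 'a \<Rightarrow> int, d :: int). (\<lambda>y. - c y, 1 - d)"
  have "\<exists>(c, d)\<in>?h ` F. 1 - g x = (\<Sum>y\<in>Y. of_int (c y) * x y) + of_int d"
    if x: "x \<in> cube Y" for x
  proof -
    from F(2)[OF x] obtain c d where
      cd: "(c, d) \<in> F" "g x = (\<Sum>y\<in>Y. of_int (c y) * x y) + of_int d"
      by auto
    then show ?thesis
      by (intro bexI[of _ "?h (c, d)"]) (auto simp: sum_negf)
  qed
  then have "finite_mcnaughton Y (\<lambda>x. 1 - g x)"
    using F(1) g' unfolding finite_mcnaughton_def
    by (intro conjI exI[of _ "?h ` F"]) (auto intro!: continuous_map_diff)
  moreover have "(\<lambda>x\<in>cube X. 1 - f x) = (\<lambda>x\<in>cube X. 1 - g (restrict x Y))"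
    by (auto simp: f restrict_def)
  ultimately show ?thesis
    using Y unfolding mcnaughton_def by blast
qed

lemma mcnaughton_add:
  assumes "f1 \<in> mcnaughton X" "f2 \<in> mcnaughton X"
  shows "(\<lambda>x\<in>cube X. min 1 (f1 x + f2 x)) \<in> mcnaughton X"
proof -
  from assms obtain Y1 g1 Y2 g2 where Y: "finite Y1" "Y1 \<subseteq> X" "finite Y2" "Y2 \<subseteq> X"
    and g: "finite_mcnaughton Y1 g1" "finite_mcnaughton Y2 g2"
    and f: "f1 = (\<lambda>x\<in>cube X. g1 (restrict x Y1))" "f2 = (\<lambda>x\<in>cube X. g2 (restrict x Y2))"
    unfolding mcnaughton_def by blast
  define Y where "Y = Y1 \<union> Y2"
  define h1 where "h1 = (\<lambda>x. g1 (restrict x Y1))"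
  define h2 where "h2 = (\<lambda>x. g2 (restrict x Y2))"
  have YY: "finite Y" "Y \<subseteq> X" "Y1 \<subseteq> Y" "Y2 \<subseteq> Y"
    using Y by (auto simp: Y_def)
  have h: "finite_mcnaughton Y h1" "finite_mcnaughton Y h2"
    unfolding h1_def h2_def using finite_mcnaughton_mono g YY by blast+
  from h(1) obtain F1 :: "(('a \<Rightarrow> int) \<times> int) set" where F1: "finite F1"
    "\<And>x. x \<in> cube Y \<Longrightarrow> \<exists>(c, d)\<in>F1. h1 x = (\<Sum>y\<in>Y. of_int (c y) * x y) + of_int d"
    and h1: "h1 \<in> cube Y \<rightarrow> {0..1}" "continuous_map (cube_topology Y) euclideanreal h1"
    unfolding finite_mcnaughton_def by blast
  from h(2) obtain F2 :: "(('a \<Rightarrow> int) \<times> int) set" where F2: "finite F2"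
    "\<And>x. x \<in> cube Y \<Longrightarrow> \<exists>(c, d)\<in>F2. h2 x = (\<Sum>y\<in>Y. of_int (c y) * x y) + of_int d"
    and h2: "h2 \<in> cube Y \<rightarrow> {0..1}" "continuous_map (cube_topology Y) euclideanreal h2"
    unfolding finite_mcnaughton_def by blast
  let ?s = "\<lambda>((c :: 'a \<Rightarrow> int, d :: int), (c' :: 'a \<Rightarrow> int, d' :: int)). (\<lambda>y. c y + c' y, d + d')"
  let ?F = "insert (\<lambda>_. 0, 1) (?s ` (F1 \<times> F2))"
  have "\<exists>(c, d)\<in>?F. min 1 (h1 x + h2 x) = (\<Sum>y\<in>Y. of_int (c y) * x y) + of_int d"
    if x: "x \<in> cube Y" for x
  proof (cases "h1 x + h2 x \<ge> 1")
    case True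
    then show ?thesis
      by (intro bexI[of _ "(\<lambda>_. 0, 1)"]) auto
  next
    case False
    from F1(2)[OF x] obtain c d where
      cd: "(c, d) \<in> F1" "h1 x = (\<Sum>y\<in>Y. of_int (c y) * x y) + of_int d"
      by auto
    from F2(2)[OF x] obtain c' d' where
      cd': "(c', d') \<in> F2" "h2 x = (\<Sum>y\<in>Y. of_int (c' y) * x y) + of_int d'"
      by auto
    have "?s ((c, d), (c', d')) \<in> ?F"
      using cd(1) cd'(1) by blast
    moreover have "min 1 (h1 x + h2 x) =
        (\<Sum>y\<in>Y. of_int (c y + c' y) * x y) + of_int (d + d')"
      using False cd(2) cd'(2) by (simp add: sum.distrib algebra_simps)
    ultimately show ?thesis
      by (intro bexI[of _ "?s ((c, d), (c', d'))"]) auto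
  qed
  moreover have "finite ?F"
    using F1(1) F2(1) by simp
  moreover have "(\<lambda>x. min 1 (h1 x + h2 x)) \<in> cube Y \<rightarrow> {0..1}"
    using h1(1) h2(1) by (auto simp: Pi_iff)
  moreover have "continuous_map (cube_topology Y) euclideanreal (\<lambda>x. min 1 (h1 x + h2 x))"
    using h1(2) h2(2) by (intro continuous_map_real_min continuous_map_add) auto
  ultimately have "finite_mcnaughton Y (\<lambda>x. min 1 (h1 x + h2 x))"
    unfolding finite_mcnaughton_def by (intro conjI exI[of _ ?F]) blast+
  moreover have "(\<lambda>x\<in>cube X. min 1 (f1 x + f2 x)) =
      (\<lambda>x\<in>cube X. min 1 (h1 (restrict x Y) + h2 (restrict x Y)))"
    using YY(3,4) by (intro restrict_ext) (simp add: f h1_def h2_def Int_absorb1)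
  ultimately show ?thesis
    using YY(1,2) unfolding mcnaughton_def by blast
qed

lemma mcnaughton_range:
  assumes "f \<in> mcnaughton X"
  shows "f \<in> cube X \<rightarrow>\<^sub>E {0..1}"
proof -
  from assms obtain Y g where Y: "Y \<subseteq> X" and g: "finite_mcnaughton Y g"
    and f: "f = (\<lambda>x\<in>cube X. g (restrict x Y))"
    unfolding mcnaughton_def by blast
  have "g (restrict x Y) \<in> {0..1}" if "x \<in> cube X" for x
    using g restrict_cube[OF that Y] unfolding finite_mcnaughton_def by (blast dest: funcset_mem)
  then show ?thesis
    unfolding f by (intro PiE_I) simp_all
qed

lemma mcnaughton_bounds:
  assumes "f \<in> mcnaughton X" "x \<in> cube X"
  shows "0 \<le> f x" "f x \<le> 1"
  using PiE_mem[OF mcnaughton_range[OF assms(1)] assms(2)] by simp_all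

lemma mcnaughton_eqI:
  assumes "f \<in> mcnaughton X" "\<And>x. x \<in> cube X \<Longrightarrow> h x = f x"
  shows "(\<lambda>x\<in>cube X. h x) = f"
proof
  fix x show "(\<lambda>x\<in>cube X. h x) x = f x"
    using assms(2) PiE_arb[OF mcnaughton_range[OF assms(1)]] by (cases "x \<in> cube X") auto
qed

lemma mv_algebra_free_mv: "mv_algebra (free_mv X)"
proof (rule mv_algebra.intro)
  show "comm_monoid \<lparr>carrier = carrier (free_mv X), mult = mv_add (free_mv X),
          one = mv_zero (free_mv X)\<rparr>"
  proof (rule comm_monoidI, goal_cases)
    case (3 f g h)
    then have fgh: "f \<in> mcnaughton X" "g \<in> mcnaughton X" "h \<in> mcnaughton X"
      by (simp_all add: free_mv_def)
    have "min 1 (min 1 (f x + g x) + h x) = min 1 (f x + min 1 (g x + h x))"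
      if x: "x \<in> cube X" for x
      using mcnaughton_bounds[OF fgh(1) x] mcnaughton_bounds[OF fgh(3) x] by linarith
    then show ?case
      by (simp add: free_mv_def cong: restrict_cong)
  next
    case (4 f)
    then have f: "f \<in> mcnaughton X"
      by (simp add: free_mv_def)
    show ?case
      using mcnaughton_bounds[OF f] by (simp add: free_mv_def) (rule mcnaughton_eqI[OF f], simp)
  qed (simp_all add: free_mv_def mcnaughton_add mcnaughton_zero add.commute)
next
  fix x assume "x \<in> carrier (free_mv X)"
  then show "mv_neg (free_mv X) x \<in> carrier (free_mv X)"
    by (simp add: free_mv_def mcnaughton_neg)
next
  fix f assume "f \<in> carrier (free_mv X)"
  then have f: "f \<in> mcnaughton X"
    by (simp add: free_mv_def)
  show "mv_neg (free_mv X) (mv_neg (free_mv X) f) = f"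
    by (simp add: free_mv_def) (rule mcnaughton_eqI[OF f], simp)
  show "mv_add (free_mv X) f (mv_neg (free_mv X) (mv_zero (free_mv X)))
      = mv_neg (free_mv X) (mv_zero (free_mv X))"
    using mcnaughton_bounds[OF f] by (simp add: free_mv_def cong: restrict_cong)
next
  fix f g assume "f \<in> carrier (free_mv X)" "g \<in> carrier (free_mv X)"
  then have fg: "f \<in> mcnaughton X" "g \<in> mcnaughton X"
    by (simp_all add: free_mv_def)
  have "min 1 (1 - min 1 (1 - f x + g x) + g x) = min 1 (1 - min 1 (1 - g x + f x) + f x)"
    if x: "x \<in> cube X" for x
    using mcnaughton_bounds[OF fg(1) x] mcnaughton_bounds[OF fg(2) x] by linarith
  then show "mv_add (free_mv X) (mv_neg (free_mv X) (mv_add (free_mv X) (mv_neg (free_mv X) f) g)) g =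
        mv_add (free_mv X) (mv_neg (free_mv X) (mv_add (free_mv X) (mv_neg (free_mv X) g) f)) f"
    by (simp add: free_mv_def cong: restrict_cong)
qed


section \<open>Rational polyhedra\<close>

text \<open>The library notions need a type of vectors, but \<open>\<real>\<^sup>Y\<close> with a set \<open>Y\<close> of coordinates is
  not one; so affine independence and convex envelope are spelled out
  coordinatewise.\<close>

definition affinely_independent :: "'k set \<Rightarrow> ('k \<Rightarrow> real) set \<Rightarrow> bool" where
  "affinely_independent Y V \<longleftrightarrow>
     (\<forall>c. (\<Sum>v\<in>V. c v) = 0 \<and> (\<forall>y\<in>Y. (\<Sum>v\<in>V. c v * v y) = 0) \<longrightarrow> (\<forall>v\<in>V. c v = 0))"

definition convex_envelope :: "'k set \<Rightarrow> ('k \<Rightarrow> real) set \<Rightarrow> ('k \<Rightarrow> real) set" where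
  "convex_envelope Y V =
     {\<lambda>y\<in>Y. \<Sum>v\<in>V. c v * v y | c. (\<forall>v\<in>V. 0 \<le> c v) \<and> (\<Sum>v\<in>V. c v) = 1}"

definition rational_simplex :: "'k set \<Rightarrow> ('k \<Rightarrow> real) set \<Rightarrow> bool" where
  "rational_simplex Y S \<longleftrightarrow>
     (\<exists>V. finite V \<and> V \<subseteq> cube Y \<and> (\<forall>v\<in>V. \<forall>y\<in>Y. v y \<in> \<rat>) \<and>
          affinely_independent Y V \<and> S = convex_envelope Y V)"

definition rational_polyhedron :: "'k set \<Rightarrow> ('k \<Rightarrow> real) set \<Rightarrow> bool" where
  "rational_polyhedron Y P \<longleftrightarrow>
     (\<exists>\<S>. finite \<S> \<and> (\<forall>S\<in>\<S>. rational_simplex Y S) \<and> P = \<Union>\<S>)"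

definition cylinder_rational_polyhedra :: "'k set \<Rightarrow> ('k \<Rightarrow> real) set set" where
  "cylinder_rational_polyhedra X =
     {{f \<in> cube X. restrict f Y \<in> P} | Y P. finite Y \<and> Y \<subseteq> X \<and> rational_polyhedron Y P}"


section \<open>Lattices of sets and anti-isomorphisms\<close>

definition inclusion_order :: "'a set set \<Rightarrow> 'a set gorder" where
  "inclusion_order \<F> = \<lparr>carrier = \<F>, eq = (=), le = (\<subseteq>)\<rparr>"

definition lattice_anti_isomorphism ::
    "('a, 'm) gorder_scheme \<Rightarrow> ('b, 'n) gorder_scheme \<Rightarrow> ('a \<Rightarrow> 'b) \<Rightarrow> bool" where
  "lattice_anti_isomorphism L M \<phi> \<longleftrightarrow>
     lattice L \<and> lattice M \<and> bij_betw \<phi> (carrier L) (carrier M) \<and>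
     (\<forall>x\<in>carrier L. \<forall>y\<in>carrier L.
        \<phi> (x \<squnion>\<^bsub>L\<^esub> y) = \<phi> x \<sqinter>\<^bsub>M\<^esub> \<phi> y \<and> \<phi> (x \<sqinter>\<^bsub>L\<^esub> y) = \<phi> x \<squnion>\<^bsub>M\<^esub> \<phi> y)"

end

theory Submission
  imports Defs
begin

text \<open>
  All operations of the free algebra are pointwise, so its ideals can be handled with ordinary
  inequalities between real functions. Call \<open>mv_Spec_open (free_mv X) a\<close> the basic open set of
  \<open>a\<close>. Basic open sets are closed under finite unions and intersections (truncated sums and
  minima), and each is compact because the prime ideal theorem turns a cover into membership in a
  generated ideal. Hence the compact open sets are exactly the basic open sets
  (\<open>compact_opens_Spec\<close>). An irreducible closed set is the closure of the intersection of its
  members, which is a prime ideal (\<open>mv_prime_ideal_Inter_irreducible\<close>), so the spectrum is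
  spectral.

  The anti-isomorphism sends the basic open set of \<open>a\<close> to the zero set of \<open>a\<close>. Two facts about
  McNaughton functions make this work. First, \<open>a\<close> vanishes wherever \<open>b\<close> does iff \<open>a \<le> n b\<close> for
  some \<open>n\<close> (\<open>mcnaughton_dominated\<close>); so the zero set of \<open>a\<close> determines the basic open set of \<open>a\<close>, and
  conversely (\<open>Spec_open_subset_iff\<close>). Second, the zero sets are precisely the cylinder
  rational polyhedra (\<open>cylinder_rational_polyhedra_eq\<close>).

  Both rest on polytopes. A McNaughton function built from a finite set \<open>F\<close> of affine forms is
  affine on each set of points that weakly preserve the order in which the members of \<open>F\<close> are
  arranged at some given point (\<open>piecewise_in_affine_on_cell\<close>). These finitely many sets are cut out
  by integral inequalities, so each is the convex envelope of finitely many rational points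
  (\<open>hpoly_vertices\<close>). Comparing two functions at these points gives the first fact, and
  Caratheodory's theorem turns zero sets into finite unions of rational simplexes. Conversely,
  Fourier-Motzkin elimination describes a rational simplex by integral inequalities
  (\<open>convex_envelope_eq_hpoly\<close>), and these are zero conditions on McNaughton functions.
\<close>

section \<open>Integral affine forms and the polytopes they cut out\<close>

text \<open>A pair \<open>p\<close> of integer coefficients and constant term is kept as syntax rather than as the
  function \<open>iform Y p\<close>, so that families of affine forms can be finite sets whose
  members are visibly integral.\<close>

definition iform :: "'k set \<Rightarrow> ('k \<Rightarrow> int) \<times> int \<Rightarrow> ('k \<Rightarrow> real) \<Rightarrow> real" where
  "iform Y p x = (\<Sum>y\<in>Y. of_int (fst p y) * x y) + of_int (snd p)"

definition hpoly :: "'k set \<Rightarrow> (('k \<Rightarrow> int) \<times> int) set \<Rightarrow> ('k \<Rightarrow> real) set" where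
  "hpoly Y C = {x \<in> cube Y. \<forall>p\<in>C. 0 \<le> iform Y p x}"

definition coord_form :: "'k \<Rightarrow> ('k \<Rightarrow> int) \<times> int" where
  "coord_form y = ((\<lambda>z. if z = y then 1 else 0), 0)"

definition cocoord_form :: "'k \<Rightarrow> ('k \<Rightarrow> int) \<times> int" where
  "cocoord_form y = ((\<lambda>z. if z = y then - 1 else 0), 1)"

definition box_forms :: "'k set \<Rightarrow> (('k \<Rightarrow> int) \<times> int) set" where
  "box_forms Y = coord_form ` Y \<union> cocoord_form ` Y"

text \<open>Taking \<open>t\<close> outside the unit interval is intended: \<open>lerp Y t x w\<close> runs through the whole
  line through \<open>x\<close> and \<open>w\<close>, and \<open>lerp Y (- 1) x w\<close> is the reflection of \<open>w\<close> in \<open>x\<close>.\<close>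

definition lerp :: "'k set \<Rightarrow> real \<Rightarrow> ('k \<Rightarrow> real) \<Rightarrow> ('k \<Rightarrow> real) \<Rightarrow> 'k \<Rightarrow> real" where
  "lerp Y t x w = (\<lambda>y\<in>Y. (1 - t) * x y + t * w y)"

lemma iform_coord: "finite Y \<Longrightarrow> y \<in> Y \<Longrightarrow> iform Y (coord_form y) x = x y"
  by (simp add: iform_def coord_form_def sum.remove[of Y y])

lemma iform_cocoord: "finite Y \<Longrightarrow> y \<in> Y \<Longrightarrow> iform Y (cocoord_form y) x = 1 - x y"
  by (simp add: iform_def cocoord_form_def sum.remove[of Y y])

lemma finite_box_forms: "finite Y \<Longrightarrow> finite (box_forms Y)"
  by (simp add: box_forms_def)

lemma cube_eq_box_forms:
  assumes "finite Y"
  shows "cube Y = {x \<in> extensional Y. \<forall>p\<in>box_forms Y. 0 \<le> iform Y p x}"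
  using assms
  by (auto simp: cube_def PiE_def box_forms_def iform_coord iform_cocoord ball_Un)

lemma lerp_extensional [simp]: "lerp Y t x w \<in> extensional Y"
  by (simp add: lerp_def)

lemma cube_extensional: "x \<in> cube Y \<Longrightarrow> x \<in> extensional Y"
  by (simp add: cube_def PiE_def)

lemma iform_lerp: "iform Y p (lerp Y t x w) = (1 - t) * iform Y p x + t * iform Y p w"
proof -
  have "iform Y p (lerp Y t x w) =
      (\<Sum>y\<in>Y. (1 - t) * (of_int (fst p y) * x y) + t * (of_int (fst p y) * w y)) + of_int (snd p)"
    unfolding iform_def lerp_def by (intro arg_cong2[of _ _ _ _ "(+)"] sum.cong) (auto simp: algebra_simps)
  then show ?thesis
    unfolding iform_def sum.distrib sum_distrib_left[symmetric] by (simp add: algebra_simps)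
qed

lemma iform_convex_combination:
  assumes "(\<Sum>v\<in>V. c v) = 1"
  shows "iform Y p (\<lambda>y\<in>Y. \<Sum>v\<in>V. c v * v y) = (\<Sum>v\<in>V. c v * iform Y p v)"
proof -
  have "(\<Sum>v\<in>V. c v * iform Y p v)
      = (\<Sum>v\<in>V. \<Sum>y\<in>Y. c v * (of_int (fst p y) * v y)) + (\<Sum>v\<in>V. c v) * of_int (snd p)"
    unfolding iform_def by (simp add: distrib_left sum.distrib sum_distrib_left sum_distrib_right)
  also have "(\<Sum>v\<in>V. \<Sum>y\<in>Y. c v * (of_int (fst p y) * v y)) =
      (\<Sum>y\<in>Y. of_int (fst p y) * (\<Sum>v\<in>V. c v * v y))"
    by (subst sum.swap) (simp add: sum_distrib_left algebra_simps)
  finally show ?thesis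
    using assms by (simp add: iform_def)
qed

lemma convex_envelope_base:
  assumes "finite V" "v \<in> V" "v \<in> extensional Y"
  shows "v \<in> convex_envelope Y V"
proof -
  have "v = (\<lambda>y\<in>Y. \<Sum>u\<in>V. (if u = v then 1 else 0) * u y)"
    using assms by (intro extensionalityI[of _ Y]) (auto simp: sum.remove[of V v])
  then show ?thesis
    unfolding convex_envelope_def using assms
    by (intro CollectI exI[of _ "\<lambda>u. if u = v then 1 else 0"]) auto
qed

lemma convex_envelope_lerp:
  assumes "x \<in> convex_envelope Y V" "w \<in> convex_envelope Y V" "0 \<le> t" "t \<le> 1"
  shows "lerp Y t x w \<in> convex_envelope Y V"
proof -
  obtain c d where c: "\<forall>v\<in>V. 0 \<le> c v" "(\<Sum>v\<in>V. c v) = 1" "x = (\<lambda>y\<in>Y. \<Sum>v\<in>V. c v * v y)"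
    and d: "\<forall>v\<in>V. 0 \<le> d v" "(\<Sum>v\<in>V. d v) = 1" "w = (\<lambda>y\<in>Y. \<Sum>v\<in>V. d v * v y)"
    using assms(1,2) unfolding convex_envelope_def by blast
  let ?e = "\<lambda>v. (1 - t) * c v + t * d v"
  have "lerp Y t x w = (\<lambda>y\<in>Y. \<Sum>v\<in>V. ?e v * v y)"
    unfolding lerp_def
    by (intro restrict_ext) (simp add: c(3) d(3) distrib_right sum.distrib sum_distrib_left mult.assoc)
  moreover have "\<forall>v\<in>V. 0 \<le> ?e v" "(\<Sum>v\<in>V. ?e v) = 1"
    using c(1,2) d(1,2) assms(3,4) by (auto simp: sum.distrib sum_distrib_left[symmetric])
  ultimately show ?thesis
    unfolding convex_envelope_def by (intro CollectI exI[of _ ?e] conjI)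
qed

lemma convex_envelope_hpoly:
  assumes "finite Y" "V \<subseteq> hpoly Y C"
  shows "convex_envelope Y V \<subseteq> hpoly Y C"
proof
  fix x assume "x \<in> convex_envelope Y V"
  then obtain c where c: "\<forall>v\<in>V. 0 \<le> c v" "(\<Sum>v\<in>V. c v) = 1" "x = (\<lambda>y\<in>Y. \<Sum>v\<in>V. c v * v y)"
    unfolding convex_envelope_def by blast
  have "0 \<le> iform Y p x" if "p \<in> box_forms Y \<union> C" for p
  proof -
    have "0 \<le> iform Y p v" if "v \<in> V" for v
      using assms(2) that \<open>p \<in> box_forms Y \<union> C\<close> unfolding hpoly_def cube_eq_box_forms[OF assms(1)] by blast
    then show ?thesis
      unfolding c(3) iform_convex_combination[OF c(2)] using c(1) by (intro sum_nonneg mult_nonneg_nonneg) auto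
  qed
  moreover have "x \<in> extensional Y"
    using c(3) by simp
  ultimately show "x \<in> hpoly Y C"
    unfolding hpoly_def cube_eq_box_forms[OF assms(1)] by blast
qed

section \<open>Polytopes given by inequalities are convex envelopes of their rational vertices\<close>

text \<open>Extend \<open>{1}\<close> to a basis of \<open>\<real>\<close> over \<open>\<rat>\<close> and project onto the coordinate of \<open>1\<close>.\<close>

lemma ex_rational_retraction:
  obtains \<phi> :: "real \<Rightarrow> real" where "\<And>x y. \<phi> (x + y) = \<phi> x + \<phi> y"
    "\<And>q x. q \<in> \<rat> \<Longrightarrow> \<phi> (q * x) = q * \<phi> x" "\<phi> 1 = 1" "\<And>x. \<phi> x \<in> \<rat>"
proof -
  interpret Q: vector_space_pair "\<lambda>(q::rat) (x::real). of_rat q * x" "\<lambda>(q::rat) (x::real). of_rat q * x"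
    by unfold_locales (auto simp: algebra_simps of_rat_add of_rat_mult)
  have ind: "Q.vs1.independent {1::real}"
    by (simp add: Q.vs1.dependent_single)
  define \<phi> where "\<phi> = Q.construct {1} (\<lambda>x. x)"
  have lin: "Vector_Spaces.linear (\<lambda>(q::rat) (x::real). of_rat q * x) (\<lambda>(q::rat) (x::real). of_rat q * x) \<phi>"
    unfolding \<phi>_def by (rule Q.linear_construct[OF ind])
  then interpret L: Vector_Spaces.linear "\<lambda>(q::rat) (x::real). of_rat q * x" "\<lambda>(q::rat) (x::real). of_rat q * x" \<phi> .
  show ?thesis
  proof
    show "\<phi> (x + y) = \<phi> x + \<phi> y" for x y by (rule L.add)
    show "\<phi> (q * x) = q * \<phi> x" if "q \<in> \<rat>" for q x
      using that L.scale by (auto elim!: Rats_cases)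
    show "\<phi> 1 = 1" unfolding \<phi>_def by (subst Q.construct_basis[OF ind]) auto
    show "\<phi> x \<in> \<rat>" for x
    proof -
      have "\<phi> x \<in> Q.vs1.span ((\<lambda>x. x) ` {1})"
        unfolding \<phi>_def by (rule Q.construct_in_span[OF ind])
      then show ?thesis
        by (auto simp: Q.vs1.span_singleton)
    qed
  qed
qed

text \<open>A \<open>\<rat>\<close>-linear retraction of \<open>\<real>\<close> onto \<open>\<rat>\<close> maps solutions of a linear system with integer
  coefficients to solutions, coordinate by coordinate. Applied to the only solution it must
  return that solution, which is therefore rational.\<close>

lemma unique_solution_rational:
  assumes Y: "finite Y"
    and v: "v \<in> extensional Y" "\<forall>p\<in>T. iform Y p v = 0"
    and uniq: "\<And>w. w \<in> extensional Y \<Longrightarrow> \<forall>p\<in>T. iform Y p w = 0 \<Longrightarrow> w = v"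
    and y: "y \<in> Y"
  shows "v y \<in> \<rat>"
proof -
  obtain \<phi> :: "real \<Rightarrow> real" where add: "\<And>x y. \<phi> (x + y) = \<phi> x + \<phi> y"
    and scale: "\<And>q x. q \<in> \<rat> \<Longrightarrow> \<phi> (q * x) = q * \<phi> x" and one: "\<phi> 1 = 1" and rat: "\<And>x. \<phi> x \<in> \<rat>"
    using ex_rational_retraction by blast
  have zero: "\<phi> 0 = 0" using add[of 0 0] by simp
  have sum: "\<phi> (\<Sum>y\<in>Z. f y) = (\<Sum>y\<in>Z. \<phi> (f y))" if "finite Z" for Z :: "'a set" and f
    using that by induction (auto simp: zero add)
  have int: "\<phi> (of_int d) = of_int d" for d
    using scale[of "of_int d" 1] one by simp
  have "iform Y p (\<lambda>y\<in>Y. \<phi> (v y)) = \<phi> (iform Y p v)" for p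
    by (simp add: iform_def add sum[OF Y] scale int)
  then have "(\<lambda>y\<in>Y. \<phi> (v y)) = v"
    using v zero by (intro uniq) auto
  then have "v y = \<phi> (v y)"
    using y by (metis restrict_apply')
  then show ?thesis
    using rat by metis
qed

text \<open>The tight constraints at \<open>x\<close> hold on the entire line through \<open>x\<close> and \<open>w\<close>. The polytope is
  bounded, so that the ray from \<open>x\<close> towards \<open>w\<close> leaves it, and where it does so a further
  constraint becomes tight.\<close>

lemma ray_to_facet:
  assumes Y: "finite Y" and D: "finite D" "box_forms Y \<subseteq> D"
    and x: "x \<in> extensional Y" "\<forall>p\<in>D. 0 \<le> iform Y p x"
    and w: "w \<in> extensional Y" "w \<noteq> x" "\<And>p. p \<in> D \<Longrightarrow> iform Y p x = 0 \<Longrightarrow> iform Y p w = 0"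
  obtains s where "s > 0" "\<forall>p\<in>D. 0 \<le> iform Y p (lerp Y s x w)"
    "{p\<in>D. iform Y p x = 0} \<subset> {p\<in>D. iform Y p (lerp Y s x w) = 0}"
proof -
  define slope where "slope p = iform Y p w - iform Y p x" for p
  have val: "iform Y p (lerp Y s x w) = iform Y p x + s * slope p" for p s
    by (simp add: iform_lerp slope_def algebra_simps)
  define N where "N = {p\<in>D. slope p < 0}"
  have "finite N" using D by (simp add: N_def)
  obtain y where y: "y \<in> Y" "w y \<noteq> x y"
    using x(1) w(1,2) by (metis extensionalityI)
  \<comment> \<open>Boundedness: one of the two box constraints on a coordinate that moves decreases.\<close>
  have "coord_form y \<in> D" "cocoord_form y \<in> D"
    using D(2) y(1) by (auto simp: box_forms_def)
  moreover have "slope (coord_form y) < 0 \<or> slope (cocoord_form y) < 0"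
    using y Y by (auto simp: slope_def iform_coord iform_cocoord)
  ultimately have "N \<noteq> {}" unfolding N_def by blast
  define s where "s = Min ((\<lambda>p. iform Y p x / - slope p) ` N)"
  have "s \<in> (\<lambda>p. iform Y p x / - slope p) ` N"
    unfolding s_def using \<open>finite N\<close> \<open>N \<noteq> {}\<close> by (intro Min_in) auto
  then obtain q where q: "q \<in> N" "s = iform Y q x / - slope q" by blast
  have le: "s \<le> iform Y p x / - slope p" if "p \<in> N" for p
    unfolding s_def using \<open>finite N\<close> that by (intro Min_le) auto
  have pos: "0 < iform Y p x" if "p \<in> N" for p
    using that x(2) w(3)[of p] unfolding N_def slope_def by force
  have s: "s > 0"
    using q pos[OF q(1)] by (simp add: N_def divide_pos_neg)
  have "0 \<le> iform Y p (lerp Y s x w)" if "p \<in> D" for p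
  proof (cases "p \<in> N")
    case True
    then have "s * - slope p \<le> iform Y p x"
      using le[OF True] by (simp add: N_def field_simps)
    then show ?thesis unfolding val by simp
  next
    case False
    then have "0 \<le> slope p" using that by (simp add: N_def)
    then show ?thesis unfolding val using x(2) that s by simp
  qed
  moreover have "{p\<in>D. iform Y p x = 0} \<subset> {p\<in>D. iform Y p (lerp Y s x w) = 0}"
  proof (rule psubsetI)
    show "{p\<in>D. iform Y p x = 0} \<subseteq> {p\<in>D. iform Y p (lerp Y s x w) = 0}"
      using w(3) by (auto simp: iform_lerp)
    have "iform Y q (lerp Y s x w) = 0"
      using q(1) unfolding val q(2) by (simp add: N_def)
    then have "q \<in> {p\<in>D. iform Y p (lerp Y s x w) = 0}"
      using q(1) by (simp add: N_def)
    then show "{p\<in>D. iform Y p x = 0} \<noteq> {p\<in>D. iform Y p (lerp Y s x w) = 0}"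
      using pos[OF q(1)] by (metis (mono_tags, lifting) less_irrefl mem_Collect_eq)
  qed
  ultimately show ?thesis using that s by blast
qed

lemma lerp_between:
  assumes "s > 0" "t > 0" "x \<in> extensional Y"
  shows "lerp Y (s / (s + t)) (lerp Y s x w) (lerp Y t x (lerp Y (- 1) x w)) = x"
proof (rule extensionalityI[of _ Y])
  fix y assume "y \<in> Y"
  then show "lerp Y (s / (s + t)) (lerp Y s x w) (lerp Y t x (lerp Y (- 1) x w)) y = x y"
    using assms by (simp add: lerp_def divide_simps) (simp add: algebra_simps)
qed (use assms in auto)

text \<open>A vertex is a point that is determined by its tight constraints. It is rational, and there are
  only finitely many since a vertex can be recovered from a subset of the constraints. A point
  that is not a vertex lies on a line along which its tight constraints persist; following the
  line in both directions up to the boundary exhibits it as a convex combination of two points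
  with more tight constraints, and induction applies.\<close>

lemma hpoly_vertices:
  assumes Y: "finite Y" and C: "finite C"
  obtains V where "finite V" "V \<subseteq> hpoly Y C" "\<forall>v\<in>V. \<forall>y\<in>Y. v y \<in> \<rat>"
    "hpoly Y C = convex_envelope Y V"
proof -
  define D where "D = box_forms Y \<union> C"
  have D: "finite D" "box_forms Y \<subseteq> D"
    using C finite_box_forms[OF Y] by (auto simp: D_def)
  have P: "hpoly Y C = {x \<in> extensional Y. \<forall>p\<in>D. 0 \<le> iform Y p x}"
    by (auto simp: hpoly_def cube_eq_box_forms[OF Y] D_def)
  define tight where "tight x = {p\<in>D. iform Y p x = 0}" for x
  define V where "V = {v \<in> hpoly Y C. \<forall>w\<in>extensional Y. (\<forall>p\<in>tight v. iform Y p w = 0) \<longrightarrow> w = v}"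
  have Vsub: "V \<subseteq> hpoly Y C" by (auto simp: V_def)
  have "inj_on tight V"
  proof (rule inj_onI)
    fix v w assume *: "v \<in> V" "w \<in> V" "tight v = tight w"
    then have "\<forall>p\<in>tight v. iform Y p w = 0" "w \<in> extensional Y"
      by (auto simp: tight_def V_def P)
    then show "v = w" using *(1) by (auto simp: V_def)
  qed
  moreover have "finite (tight ` V)"
    by (rule finite_subset[of _ "Pow D"]) (use D in \<open>auto simp: tight_def\<close>)
  ultimately have finV: "finite V" by (rule finite_imageD[rotated])
  have ratV: "v y \<in> \<rat>" if "v \<in> V" "y \<in> Y" for v y
    by (rule unique_solution_rational[OF Y, of v "tight v"]) (use that in \<open>auto simp: V_def P tight_def\<close>)
  have "x \<in> convex_envelope Y V" if "x \<in> hpoly Y C" for x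
    using that
  proof (induction "card (D - tight x)" arbitrary: x rule: less_induct)
    case less
    have xP: "x \<in> extensional Y" "\<forall>p\<in>D. 0 \<le> iform Y p x"
      using less.prems by (auto simp: P)
    show ?case
    proof (cases "x \<in> V")
      case True
      then show ?thesis using finV xP(1) by (intro convex_envelope_base)
    next
      case False
      then obtain w where w: "w \<in> extensional Y" "\<forall>p\<in>tight x. iform Y p w = 0" "w \<noteq> x"
        using less.prems unfolding V_def by blast
      let ?w' = "lerp Y (- 1) x w"
      have wt: "iform Y p w = 0" if "p \<in> D" "iform Y p x = 0" for p
        using w(2) that unfolding tight_def by blast
      obtain s where s: "s > 0" "\<forall>p\<in>D. 0 \<le> iform Y p (lerp Y s x w)" "tight x \<subset> tight (lerp Y s x w)"
        unfolding tight_def by (rule ray_to_facet[OF Y D xP w(1,3) wt])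
      have w'x: "?w' \<noteq> x"
      proof
        assume eq: "?w' = x"
        have "w y = x y" if "y \<in> Y" for y
          using fun_cong[OF eq, of y] that by (simp add: lerp_def)
        then show False using w xP(1) by (metis extensionalityI)
      qed
      obtain t where t: "t > 0" "\<forall>p\<in>D. 0 \<le> iform Y p (lerp Y t x ?w')" "tight x \<subset> tight (lerp Y t x ?w')"
        unfolding tight_def
        by (rule ray_to_facet[OF Y D xP lerp_extensional w'x]) (auto simp: iform_lerp wt)
      have dec: "card (D - tight z) < card (D - tight x)" if "tight x \<subset> tight z" for z
      proof (rule psubset_card_mono)
        show "D - tight z \<subset> D - tight x" using that unfolding tight_def by blast
      qed (use D in auto)
      have "lerp Y s x w \<in> convex_envelope Y V"
        by (rule less.hyps[OF dec[OF s(3)]]) (use s(2) in \<open>auto simp: P\<close>)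
      moreover have "lerp Y t x ?w' \<in> convex_envelope Y V"
        by (rule less.hyps[OF dec[OF t(3)]]) (use t(2) in \<open>auto simp: P\<close>)
      ultimately have "lerp Y (s / (s + t)) (lerp Y s x w) (lerp Y t x ?w') \<in> convex_envelope Y V"
        by (rule convex_envelope_lerp) (use s(1) t(1) in \<open>auto simp: field_simps\<close>)
      then show ?thesis unfolding lerp_between[OF s(1) t(1) xP(1)] .
    qed
  qed
  then have "hpoly Y C = convex_envelope Y V"
    using convex_envelope_hpoly[OF Y Vsub] by blast
  then show ?thesis using that finV Vsub ratV by blast
qed

lemma convex_envelope_mono:
  assumes "finite V" "W \<subseteq> V"
  shows "convex_envelope Y W \<subseteq> convex_envelope Y V"
proof
  fix x assume "x \<in> convex_envelope Y W"
  then obtain c where c: "\<forall>v\<in>W. 0 \<le> c v" "(\<Sum>v\<in>W. c v) = 1" "x = (\<lambda>y\<in>Y. \<Sum>v\<in>W. c v * v y)"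
    unfolding convex_envelope_def by blast
  let ?c = "\<lambda>v. if v \<in> W then c v else 0"
  have ext: "(\<Sum>v\<in>V. ?c v * f v) = (\<Sum>v\<in>W. c v * f v)" for f
    by (rule sum.mono_neutral_cong_right) (use assms in auto)
  show "x \<in> convex_envelope Y V"
    unfolding convex_envelope_def
    using c ext[of "\<lambda>_. 1"] by (intro CollectI exI[of _ ?c]) (auto simp: ext)
qed

text \<open>Subtract a multiple of an affine dependence from the coefficients of \<open>x\<close>, as large as
  nonnegativity permits: the first coefficient to vanish belongs to a point that can be omitted.\<close>

lemma convex_envelope_drop_point:
  assumes V: "finite V" and x: "x \<in> convex_envelope Y V" and dep: "\<not> affinely_independent Y V"
  obtains v where "v \<in> V" "x \<in> convex_envelope Y (V - {v})"
proof -
  obtain c where c: "\<forall>v\<in>V. 0 \<le> c v" "(\<Sum>v\<in>V. c v) = 1" "x = (\<lambda>y\<in>Y. \<Sum>v\<in>V. c v * v y)"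
    using x unfolding convex_envelope_def by blast
  obtain e u where e: "(\<Sum>v\<in>V. e v) = 0" "\<forall>y\<in>Y. (\<Sum>v\<in>V. e v * v y) = 0" "u \<in> V" "e u \<noteq> 0"
    using dep unfolding affinely_independent_def by blast
  define N where "N = {v\<in>V. e v > 0}"
  have "finite N" using V by (simp add: N_def)
  have "N \<noteq> {}"
  proof
    assume "N = {}"
    then have "\<forall>v\<in>V. 0 \<le> - e v" by (auto simp: N_def not_less)
    moreover have "(\<Sum>v\<in>V. - e v) = 0" using e(1) by (simp add: sum_negf)
    ultimately have "- e u = 0" using sum_nonneg_eq_0_iff[OF V, of "\<lambda>v. - e v"] e(3) by blast
    then show False using e(4) by simp
  qed
  define t where "t = Min ((\<lambda>v. c v / e v) ` N)"
  have "t \<in> (\<lambda>v. c v / e v) ` N"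
    unfolding t_def using \<open>finite N\<close> \<open>N \<noteq> {}\<close> by (intro Min_in) auto
  then obtain v where v: "v \<in> N" "t = c v / e v" by blast
  have le: "t \<le> c z / e z" if "z \<in> N" for z
    unfolding t_def using \<open>finite N\<close> that by (intro Min_le) auto
  have t: "0 \<le> t" using v c(1) by (auto simp: N_def)
  let ?d = "\<lambda>z. c z - t * e z"
  have nonneg: "0 \<le> ?d z" if "z \<in> V" for z
  proof (cases "z \<in> N")
    case True
    then show ?thesis using le[OF True] by (simp add: N_def field_simps)
  next
    case False
    then have "t * e z \<le> 0" using that t by (simp add: N_def mult_nonneg_nonpos)
    then show ?thesis using c(1) that by fastforce
  qed
  have vV: "v \<in> V" and dv: "?d v = 0" using v by (auto simp: N_def)
  have red: "(\<Sum>z\<in>V - {v}. ?d z * f z) = (\<Sum>z\<in>V. c z * f z) - t * (\<Sum>z\<in>V. e z * f z)" for f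
  proof -
    have "(\<Sum>z\<in>V - {v}. ?d z * f z) = (\<Sum>z\<in>V. ?d z * f z)"
      using V vV dv by (simp add: sum.remove[of V v])
    also have "\<dots> = (\<Sum>z\<in>V. c z * f z) - t * (\<Sum>z\<in>V. e z * f z)"
      by (simp add: left_diff_distrib sum_subtractf sum_distrib_left mult.assoc)
    finally show ?thesis .
  qed
  have "x = (\<lambda>y\<in>Y. \<Sum>z\<in>V - {v}. ?d z * z y)"
    unfolding c(3) by (intro restrict_ext) (simp add: red e(2))
  moreover have "(\<Sum>z\<in>V - {v}. ?d z) = 1"
    using red[of "\<lambda>_. 1"] c(2) e(1) by simp
  ultimately have "x \<in> convex_envelope Y (V - {v})"
    using nonneg unfolding convex_envelope_def by (intro CollectI exI[of _ ?d]) auto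
  then show ?thesis using that vV by blast
qed

text \<open>Caratheodory's theorem. The simplexes it yields may overlap, as those of a rational
  polyhedron may.\<close>

lemma caratheodory_simplexes:
  assumes "finite V" "x \<in> convex_envelope Y V"
  shows "\<exists>W\<subseteq>V. affinely_independent Y W \<and> x \<in> convex_envelope Y W"
  using assms
proof (induction "card V" arbitrary: V rule: less_induct)
  case less
  show ?case
  proof (cases "affinely_independent Y V")
    case False
    then obtain v where v: "v \<in> V" "x \<in> convex_envelope Y (V - {v})"
      using convex_envelope_drop_point less.prems by metis
    have "card (V - {v}) < card V"
      using less.prems(1) v(1) by (rule card_Diff1_less)
    then show ?thesis
      using less.hyps[of "V - {v}"] less.prems(1) v by (meson Diff_subset finite_Diff order_trans)
  qed (use less.prems in auto)
qed

lemma rational_polyhedron_convex_envelope: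
  assumes "finite V" "V \<subseteq> cube Y" "\<forall>v\<in>V. \<forall>y\<in>Y. v y \<in> \<rat>"
  shows "rational_polyhedron Y (convex_envelope Y V)"
proof -
  let ?S = "convex_envelope Y ` {W. W \<subseteq> V \<and> affinely_independent Y W}"
  have "rational_simplex Y S" if "S \<in> ?S" for S
  proof -
    from that obtain W where W: "W \<subseteq> V" "affinely_independent Y W" "S = convex_envelope Y W"
      by blast
    then have "finite W" "W \<subseteq> cube Y" "\<forall>v\<in>W. \<forall>y\<in>Y. v y \<in> \<rat>"
      using assms finite_subset by auto
    then show ?thesis
      unfolding rational_simplex_def using W(2,3) by blast
  qed
  moreover have "convex_envelope Y V = \<Union>?S"
  proof
    show "convex_envelope Y V \<subseteq> \<Union>?S"
    proof
      fix x assume "x \<in> convex_envelope Y V"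
      then obtain W where "W \<subseteq> V" "affinely_independent Y W" "x \<in> convex_envelope Y W"
        using caratheodory_simplexes[OF assms(1)] by metis
      then show "x \<in> \<Union>?S" by (intro UnionI[of "convex_envelope Y W"] imageI) auto
    qed
    show "\<Union>?S \<subseteq> convex_envelope Y V"
      by (rule UN_least) (use convex_envelope_mono[OF assms(1), where Y = Y] in simp)
  qed
  moreover have "finite ?S" using assms(1) by simp
  ultimately show ?thesis unfolding rational_polyhedron_def by (intro exI[of _ ?S] conjI ballI)
qed

lemma rational_polyhedron_Union:
  assumes "finite \<P>" "\<And>P. P \<in> \<P> \<Longrightarrow> rational_polyhedron Y P"
  shows "rational_polyhedron Y (\<Union>\<P>)"
proof -
  obtain \<S> where \<S>: "\<And>P. P \<in> \<P> \<Longrightarrow> finite (\<S> P) \<and> (\<forall>S\<in>\<S> P. rational_simplex Y S) \<and> P = \<Union>(\<S> P)"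
    using assms(2) unfolding rational_polyhedron_def by metis
  have "\<Union>\<P> = (\<Union>P\<in>\<P>. \<Union>(\<S> P))"
    using SUP_cong[of \<P> \<P> "\<lambda>P. P" "\<lambda>P. \<Union>(\<S> P)"] \<S> by simp
  also have "\<dots> = \<Union>(\<Union>P\<in>\<P>. \<S> P)"
    by blast
  finally show ?thesis
    unfolding rational_polyhedron_def using assms(1) \<S>
    by (intro exI[of _ "\<Union>P\<in>\<P>. \<S> P"]) auto
qed

lemma rational_polyhedron_hpoly:
  assumes "finite Y" "finite C"
  shows "rational_polyhedron Y (hpoly Y C)"
proof -
  obtain V where "finite V" "V \<subseteq> hpoly Y C" "\<forall>v\<in>V. \<forall>y\<in>Y. v y \<in> \<rat>" "hpoly Y C = convex_envelope Y V"
    using hpoly_vertices[OF assms] by metis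
  then show ?thesis
    using rational_polyhedron_convex_envelope[of V Y] by (auto simp: hpoly_def)
qed

section \<open>Rational simplexes are cut out by integral inequalities\<close>

text \<open>The convex envelope of \<open>V\<close> is the slice \<open>s = 1\<close> of the cone spanned by the points \<open>(v, 1)\<close>.
  Linear forms in the additional variable \<open>s\<close> describe this cone, and for a cone the generators
  can be added one at a time.\<close>

definition hform :: "'k set \<Rightarrow> ('k \<Rightarrow> real) \<times> real \<Rightarrow> ('k \<Rightarrow> real) \<Rightarrow> real \<Rightarrow> real" where
  "hform Y p x s = (\<Sum>y\<in>Y. fst p y * x y) + snd p * s"

definition rational_hform :: "'k set \<Rightarrow> ('k \<Rightarrow> real) \<times> real \<Rightarrow> bool" where
  "rational_hform Y p \<longleftrightarrow> (\<forall>y\<in>Y. fst p y \<in> \<rat>) \<and> snd p \<in> \<rat>"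

definition in_cone :: "'k set \<Rightarrow> ('k \<Rightarrow> real) set \<Rightarrow> ('k \<Rightarrow> real) \<Rightarrow> real \<Rightarrow> bool" where
  "in_cone Y V x s \<longleftrightarrow>
     (\<exists>c. (\<forall>v\<in>V. 0 \<le> c v) \<and> (\<forall>y\<in>Y. x y = (\<Sum>v\<in>V. c v * v y)) \<and> s = (\<Sum>v\<in>V. c v))"

text \<open>The constraints bound \<open>t\<close> from above where \<open>r p > 0\<close> and from below where \<open>r p < 0\<close>. A
  suitable \<open>t\<close> exists iff every lower bound, \<open>0\<close> among them, is at most every upper bound, and
  the constraints with \<open>r p = 0\<close>, which do not involve \<open>t\<close>, hold.\<close>

lemma fourier_motzkin:
  fixes L r :: "'a \<Rightarrow> real"
  assumes C: "finite C"
  shows "(\<exists>t\<ge>0. \<forall>p\<in>C. t * r p \<le> L p) \<longleftrightarrow>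
    (\<forall>p\<in>C. r p \<ge> 0 \<longrightarrow> 0 \<le> L p) \<and>
    (\<forall>p\<in>C. \<forall>q\<in>C. r p > 0 \<longrightarrow> r q < 0 \<longrightarrow> 0 \<le> r p * L q - r q * L p)"
    (is "?l \<longleftrightarrow> ?r1 \<and> ?r2")
proof
  assume ?l
  then obtain t where t: "t \<ge> 0" "\<And>p. p \<in> C \<Longrightarrow> t * r p \<le> L p" by blast
  have ?r1
    using t by (meson mult_nonneg_nonneg order_trans)
  moreover have "0 \<le> r p * L q - r q * L p" if "p \<in> C" "q \<in> C" "r p > 0" "r q < 0" for p q
  proof -
    have "r p * (t * r q) \<le> r p * L q" using t(2)[OF that(2)] that by simp
    moreover have "- r q * (t * r p) \<le> - r q * L p"
      using t(2)[OF that(1)] that by (intro mult_left_mono) auto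
    ultimately show ?thesis by (simp add: algebra_simps)
  qed
  ultimately show "?r1 \<and> ?r2" by blast
next
  assume r: "?r1 \<and> ?r2"
  define M where "M = insert 0 ((\<lambda>q. L q / r q) ` {q\<in>C. r q < 0})"
  have M: "finite M" "0 \<in> M" using C by (auto simp: M_def)
  define t where "t = Max M"
  have t: "t \<in> M" "\<And>m. m \<in> M \<Longrightarrow> m \<le> t"
    using M unfolding t_def by (auto intro: Max_in)
  have "t * r p \<le> L p" if p: "p \<in> C" for p
  proof -
    consider "r p < 0" | "r p = 0" | "r p > 0" by linarith
    then show ?thesis
    proof cases
      case 1
      then have "L p / r p \<le> t" using p by (intro t(2)) (auto simp: M_def)
      then show ?thesis using 1 by (simp add: neg_divide_le_eq)
    next
      case 2
      then show ?thesis using r p by auto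
    next
      case 3
      show ?thesis
      proof (cases "t = 0")
        case True
        then show ?thesis using r p 3 by auto
      next
        case False
        then obtain q where q: "q \<in> C" "r q < 0" "t = L q / r q" using t(1) by (auto simp: M_def)
        have "0 \<le> r p * L q - r q * L p" using r p q 3 by blast
        then show ?thesis unfolding q(3) using q(2) by (simp add: divide_simps) (simp add: algebra_simps)
      qed
    qed
  qed
  then show ?l using t(2)[OF M(2)] by blast
qed

lemma in_cone_insert:
  assumes "finite V" "u \<notin> V"
  shows "in_cone Y (insert u V) x s \<longleftrightarrow> (\<exists>t\<ge>0. in_cone Y V (\<lambda>y. x y - t * u y) (s - t))"
proof
  assume "in_cone Y (insert u V) x s"
  then obtain c where c: "\<forall>v\<in>insert u V. 0 \<le> c v" "\<forall>y\<in>Y. x y = (\<Sum>v\<in>insert u V. c v * v y)"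
    "s = (\<Sum>v\<in>insert u V. c v)"
    unfolding in_cone_def by blast
  then show "\<exists>t\<ge>0. in_cone Y V (\<lambda>y. x y - t * u y) (s - t)"
    using assms unfolding in_cone_def by (intro exI[of _ "c u"] conjI exI[of _ c]) auto
next
  assume "\<exists>t\<ge>0. in_cone Y V (\<lambda>y. x y - t * u y) (s - t)"
  then obtain t c where t: "t \<ge> 0" and c: "\<forall>v\<in>V. 0 \<le> c v"
    "\<forall>y\<in>Y. x y - t * u y = (\<Sum>v\<in>V. c v * v y)" "s - t = (\<Sum>v\<in>V. c v)"
    unfolding in_cone_def by blast
  let ?c = "c(u := t)"
  have "(\<Sum>v\<in>V. ?c v * f v) = (\<Sum>v\<in>V. c v * f v)" for f
    using assms(2) by (intro sum.cong) auto
  moreover have "(\<Sum>v\<in>V. ?c v) = (\<Sum>v\<in>V. c v)"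
    using assms(2) by (intro sum.cong) auto
  ultimately show "in_cone Y (insert u V) x s"
    using assms c t unfolding in_cone_def
    by (intro exI[of _ ?c]) (auto simp: algebra_simps)
qed

lemma hform_shift: "hform Y p (\<lambda>y. x y - t * u y) (s - t) = hform Y p x s - t * hform Y p u 1"
  by (simp add: hform_def algebra_simps sum_subtractf sum_distrib_left)

text \<open>Adjoining a generator \<open>u\<close> to the cone introduces an existential quantifier over its
  coefficient \<open>t \<ge> 0\<close>, and Fourier-Motzkin elimination removes it. The combined forms have the
  rational numbers \<open>hform Y p u 1\<close> as multipliers, so rationality persists.\<close>

lemma in_cone_hforms:
  assumes Y: "finite Y" and V: "finite V" "\<forall>v\<in>V. \<forall>y\<in>Y. v y \<in> \<rat>"
  shows "\<exists>C. finite C \<and> (\<forall>p\<in>C. rational_hform Y p) \<and>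
    (\<forall>x s. in_cone Y V x s \<longleftrightarrow> (\<forall>p\<in>C. 0 \<le> hform Y p x s))"
  using V
proof (induction V rule: finite_induct)
  case empty
  define e :: "real \<Rightarrow> 'a \<Rightarrow> ('a \<Rightarrow> real) \<times> real" where "e a y = ((\<lambda>z. if z = y then a else 0), 0)" for a y
  define C where "C = e 1 ` Y \<union> e (- 1) ` Y \<union> {(\<lambda>_. 0, 1), (\<lambda>_. 0, - 1)}"
  have e: "hform Y (e a y) x s = a * x y" if "y \<in> Y" for a y x s
    using Y that by (simp add: hform_def e_def sum.remove[of Y y])
  have "in_cone Y {} x s \<longleftrightarrow> (\<forall>p\<in>C. 0 \<le> hform Y p x s)" for x s
  proof -
    have "in_cone Y {} x s \<longleftrightarrow> (\<forall>y\<in>Y. 0 \<le> x y \<and> 0 \<le> - x y) \<and> 0 \<le> s \<and> 0 \<le> - s"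
      unfolding in_cone_def by force
    also have "\<dots> \<longleftrightarrow> (\<forall>p\<in>C. 0 \<le> hform Y p x s)"
      unfolding C_def ball_Un ball_simps using e by (auto simp: hform_def)
    finally show ?thesis .
  qed
  moreover have "finite C" "\<forall>p\<in>C. rational_hform Y p"
    using Y by (auto simp: C_def rational_hform_def e_def)
  ultimately show ?case
    by (intro exI[of _ C] conjI allI)
next
  case (insert u V)
  then obtain C where C: "finite C" "\<forall>p\<in>C. rational_hform Y p"
    "\<And>x s. in_cone Y V x s \<longleftrightarrow> (\<forall>p\<in>C. 0 \<le> hform Y p x s)"
    by auto
  define r where "r p = hform Y p u 1" for p
  define comb :: "('a \<Rightarrow> real) \<times> real \<Rightarrow> ('a \<Rightarrow> real) \<times> real \<Rightarrow> ('a \<Rightarrow> real) \<times> real" where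
    "comb p q = ((\<lambda>y. r p * fst q y - r q * fst p y), r p * snd q - r q * snd p)" for p q
  have comb: "hform Y (comb p q) x s = r p * hform Y q x s - r q * hform Y p x s" for p q x s
    by (simp add: hform_def comb_def algebra_simps sum_subtractf sum_distrib_left)
  define C' where "C' = {p\<in>C. r p \<ge> 0} \<union>
    (\<lambda>(p, q). comb p q) ` ({p\<in>C. r p > 0} \<times> {q\<in>C. r q < 0})"
  have "in_cone Y (insert u V) x s \<longleftrightarrow> (\<forall>p\<in>C'. 0 \<le> hform Y p x s)" for x s
  proof -
    have "in_cone Y (insert u V) x s \<longleftrightarrow> (\<exists>t\<ge>0. \<forall>p\<in>C. t * r p \<le> hform Y p x s)"
      by (simp add: in_cone_insert[OF insert.hyps] C(3) hform_shift r_def)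
    also have "\<dots> \<longleftrightarrow> (\<forall>p\<in>C'. 0 \<le> hform Y p x s)"
      unfolding fourier_motzkin[OF C(1)] C'_def ball_Un by (auto simp: comb)
    finally show ?thesis .
  qed
  moreover have "finite C'" using C(1) by (simp add: C'_def)
  moreover have "rational_hform Y p" if p: "p \<in> C'" for p
  proof -
    have "r p \<in> \<rat>" if "p \<in> C" for p
      using C(2) that insert.prems unfolding r_def hform_def rational_hform_def
      by (intro Rats_add Rats_sum Rats_mult) auto
    then have comb_rat: "rational_hform Y (comb p q)" if "p \<in> C" "q \<in> C" for p q
      using that C(2) unfolding comb_def rational_hform_def by simp
    consider "p \<in> C" | q q' where "q \<in> C" "q' \<in> C" "p = comb q q'"
      using p unfolding C'_def by auto
    then show ?thesis
      by cases (use C(2) comb_rat in simp_all)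
  qed
  ultimately show ?case
    by (intro exI[of _ C'] conjI allI ballI)
qed

lemma common_denominator:
  assumes "finite S" "S \<subseteq> (\<rat> :: real set)"
  shows "\<exists>N::int. N > 0 \<and> (\<forall>r\<in>S. of_int N * r \<in> \<int>)"
  using assms
proof (induction S rule: finite_induct)
  case (insert r S)
  then obtain N :: int where N: "N > 0" "\<forall>r\<in>S. of_int N * r \<in> \<int>" by auto
  obtain a b :: int where ab: "b > 0" "r = of_int a / of_int b"
    using insert.prems by (auto elim: Rats_cases')
  have "of_int (N * b) * z \<in> \<int>" if "z \<in> insert r S" for z
  proof (cases "z = r")
    case True
    have "of_int (N * b) * r = of_int (N * a)" using ab by simp
    then show ?thesis using True by (metis Ints_of_int)
  next
    case False
    then have "of_int N * z \<in> \<int>" using that N(2) by auto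
    then have "of_int b * (of_int N * z) \<in> \<int>" by (rule Ints_mult[OF Ints_of_int])
    then show ?thesis by (simp add: mult_ac)
  qed
  then show ?case using N(1) ab(1) by (intro exI[of _ "N * b"]) auto
qed (auto intro: exI[of _ 1])

lemma rational_hform_iform:
  assumes Y: "finite Y" and p: "rational_hform Y p"
  shows "\<exists>q. \<forall>x. 0 \<le> iform Y q x \<longleftrightarrow> 0 \<le> hform Y p x 1"
proof -
  obtain N :: int where N: "N > 0" "\<forall>r\<in>insert (snd p) (fst p ` Y). of_int N * r \<in> \<int>"
    using common_denominator[of "insert (snd p) (fst p ` Y)"] Y p by (auto simp: rational_hform_def)
  define q where "q = ((\<lambda>y. \<lfloor>of_int N * fst p y\<rfloor>), \<lfloor>of_int N * snd p\<rfloor>)"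
  have "iform Y q x = of_int N * hform Y p x 1" for x
    using N(2) by (simp add: iform_def hform_def q_def distrib_left sum_distrib_left mult.assoc[symmetric])
  then show ?thesis using N(1) by (intro exI[of _ q]) (simp add: zero_le_mult_iff)
qed

lemma convex_envelope_eq_hpoly:
  assumes Y: "finite Y" and V: "finite V" "V \<subseteq> cube Y" "\<forall>v\<in>V. \<forall>y\<in>Y. v y \<in> \<rat>"
  shows "\<exists>C. finite C \<and> convex_envelope Y V = hpoly Y C"
proof -
  obtain C where C: "finite C" "\<forall>p\<in>C. rational_hform Y p"
    "\<And>x s. in_cone Y V x s \<longleftrightarrow> (\<forall>p\<in>C. 0 \<le> hform Y p x s)"
    using in_cone_hforms[OF Y V(1,3)] by blast
  obtain q where q: "\<And>p x. p \<in> C \<Longrightarrow> 0 \<le> iform Y (q p) x \<longleftrightarrow> 0 \<le> hform Y p x 1"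
    using C(2) rational_hform_iform[OF Y] by metis
  have sub: "convex_envelope Y V \<subseteq> cube Y"
    using convex_envelope_hpoly[OF Y, of V "{}"] V(2) by (simp add: hpoly_def)
  have cone: "x \<in> convex_envelope Y V \<longleftrightarrow> in_cone Y V x 1" if "x \<in> extensional Y" for x
  proof
    assume "in_cone Y V x 1"
    then obtain c where c: "\<forall>v\<in>V. 0 \<le> c v" "\<forall>y\<in>Y. x y = (\<Sum>v\<in>V. c v * v y)" "1 = (\<Sum>v\<in>V. c v)"
      unfolding in_cone_def by blast
    have "x = (\<lambda>y\<in>Y. \<Sum>v\<in>V. c v * v y)"
      using that c(2) by (intro extensionalityI[of _ Y]) auto
    then show "x \<in> convex_envelope Y V"
      using c(1,3) unfolding convex_envelope_def by auto
  qed (auto simp: convex_envelope_def in_cone_def)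
  have "x \<in> convex_envelope Y V \<longleftrightarrow> x \<in> hpoly Y (q ` C)" for x
  proof (cases "x \<in> cube Y")
    case True
    then show ?thesis
      using cone[OF cube_extensional[OF True]] C(3) q by (auto simp: hpoly_def)
  qed (use sub in \<open>auto simp: hpoly_def\<close>)
  then show ?thesis using C(1) by blast
qed

section \<open>McNaughton functions are affine on finitely many integral polytopes\<close>

definition form_diff :: "('k \<Rightarrow> int) \<times> int \<Rightarrow> ('k \<Rightarrow> int) \<times> int \<Rightarrow> ('k \<Rightarrow> int) \<times> int" where
  "form_diff p q = ((\<lambda>y. fst p y - fst q y), snd p - snd q)"

text \<open>The polytope of these forms consists of the points that preserve every weak inequality that
  holds at \<open>x\<close> between members of \<open>F\<close>: it is the closed cell of \<open>x\<close> in the arrangement of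
  hyperplanes on which two members of \<open>F\<close> agree. There are finitely many such cells and they
  cover the cube.\<close>

definition order_forms ::
    "'k set \<Rightarrow> (('k \<Rightarrow> int) \<times> int) set \<Rightarrow> ('k \<Rightarrow> real) \<Rightarrow> (('k \<Rightarrow> int) \<times> int) set" where
  "order_forms Y F x =
     {form_diff p q | p q. p \<in> F \<and> q \<in> F \<and> iform Y q x \<le> iform Y p x}"

definition piecewise_in :: "'k set \<Rightarrow> (('k \<Rightarrow> int) \<times> int) set \<Rightarrow> (('k \<Rightarrow> real) \<Rightarrow> real) \<Rightarrow> bool" where
  "piecewise_in Y F g \<longleftrightarrow>
     continuous_map (cube_topology Y) euclideanreal g \<and> (\<forall>x\<in>cube Y. \<exists>p\<in>F. g x = iform Y p x)"

lemma iform_diff: "iform Y (form_diff p q) x = iform Y p x - iform Y q x"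
  by (simp add: iform_def form_diff_def left_diff_distrib sum_subtractf)

lemma mem_hpoly_order_forms:
  "z \<in> hpoly Y (order_forms Y F x) \<longleftrightarrow> z \<in> cube Y \<and>
     (\<forall>p\<in>F. \<forall>q\<in>F. iform Y q x \<le> iform Y p x \<longrightarrow> iform Y q z \<le> iform Y p z)"
proof -
  have "(\<forall>r\<in>order_forms Y F x. 0 \<le> iform Y r z) \<longleftrightarrow>
      (\<forall>p\<in>F. \<forall>q\<in>F. iform Y q x \<le> iform Y p x \<longrightarrow> 0 \<le> iform Y (form_diff p q) z)"
    unfolding order_forms_def by blast
  then show ?thesis
    by (simp add: hpoly_def iform_diff)
qed

lemma order_forms_subset: "order_forms Y F x \<subseteq> (\<lambda>(p, q). form_diff p q) ` (F \<times> F)"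
  unfolding order_forms_def by auto

lemma finite_order_forms: "finite F \<Longrightarrow> finite (order_forms Y F x)"
  by (rule finite_subset[OF order_forms_subset]) simp

lemma finite_range_order_forms:
  assumes "finite F"
  shows "finite (range (order_forms Y F))"
proof (rule finite_subset)
  show "range (order_forms Y F) \<subseteq> Pow ((\<lambda>(p, q). form_diff p q) ` (F \<times> F))"
    using order_forms_subset[of Y F] by (simp add: image_subset_iff)
qed (use assms in simp)

lemma finite_mcnaughton_piecewise_in:
  assumes "finite_mcnaughton Y g"
  obtains F where "finite F" "piecewise_in Y F g"
proof -
  obtain F :: "(('a \<Rightarrow> int) \<times> int) set" where F: "finite F"
    "\<forall>x\<in>cube Y. \<exists>(c, d)\<in>F. g x = (\<Sum>y\<in>Y. of_int (c y) * x y) + of_int d"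
    using assms unfolding finite_mcnaughton_def by blast
  have "\<exists>p\<in>F. g x = iform Y p x" if "x \<in> cube Y" for x
    using bspec[OF F(2) that] by (simp add: iform_def case_prod_beta)
  then show ?thesis
    using that[of F] F(1) assms unfolding piecewise_in_def finite_mcnaughton_def by blast
qed

lemma piecewise_in_mono: "piecewise_in Y F g \<Longrightarrow> F \<subseteq> G \<Longrightarrow> piecewise_in Y G g"
  unfolding piecewise_in_def by (meson subset_eq)

lemma lerp_cube:
  assumes "x \<in> cube Y" "z \<in> cube Y" "0 \<le> t" "t \<le> 1"
  shows "lerp Y t x z \<in> cube Y"
proof -
  have "(1 - t) * x y + t * z y \<in> {0..1}" if "y \<in> Y" for y
  proof -
    have "x y \<in> {0..1}" "z y \<in> {0..1}" using assms(1,2) that by (auto simp: cube_def PiE_def Pi_def)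
    then show ?thesis
      using assms(3,4) convex_bound_le[of "x y" 1 "z y" "1 - t" t] by auto
  qed
  then show ?thesis by (auto simp: cube_def lerp_def)
qed

lemma continuous_on_segment:
  assumes x: "x \<in> cube Y" and z: "z \<in> cube Y"
    and g: "continuous_map (cube_topology Y) euclideanreal g"
  shows "continuous_on {0..1} (\<lambda>t. g (lerp Y t x z))"
proof -
  have "continuous_map (top_of_set {0..1}) (top_of_set {0..1}) (\<lambda>t. lerp Y t x z y)" if "y \<in> Y" for y
  proof -
    have "continuous_on {0..1} (\<lambda>t. lerp Y t x z y)"
      using that unfolding lerp_def by (auto intro!: continuous_intros)
    moreover have "lerp Y t x z y \<in> {0..1}" if "t \<in> {0..1}" for t
      using lerp_cube[OF x z, of t] that \<open>y \<in> Y\<close> by (auto simp: cube_def PiE_def Pi_def)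
    ultimately show ?thesis
      by (auto simp: continuous_map_in_subtopology)
  qed
  then have "continuous_map (top_of_set {0..1}) (cube_topology Y) (\<lambda>t. lerp Y t x z)"
    unfolding cube_topology_def by (subst continuous_map_componentwise) auto
  then have "continuous_map (top_of_set {0..1}) euclideanreal (g \<circ> (\<lambda>t. lerp Y t x z))"
    using g by (rule continuous_map_compose)
  then show ?thesis
    by (simp add: o_def)
qed

text \<open>On the segment from \<open>x\<close> to \<open>z\<close>, a form in \<open>F\<close> that agrees with \<open>p\<close> at \<open>x\<close> agrees with it
  throughout, and any other form differs from \<open>p\<close> by at least \<open>(1 - t) * \<delta>\<close> at parameter \<open>t\<close>.
  So \<open>g - p\<close> either vanishes or is at least that large in modulus. It is continuous and
  starts at \<open>0\<close>, hence cannot jump over the gap while \<open>t < 1\<close>, and it vanishes at \<open>t = 1\<close> by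
  continuity.\<close>

lemma piecewise_in_affine_on_cell:
  assumes F: "finite F" "piecewise_in Y F g"
    and x: "x \<in> cube Y" and z: "z \<in> hpoly Y (order_forms Y F x)"
    and p: "p \<in> F" "g x = iform Y p x"
  shows "g z = iform Y p z"
proof -
  have zc: "z \<in> cube Y" and ord: "\<And>q r. q \<in> F \<Longrightarrow> r \<in> F \<Longrightarrow> iform Y r x \<le> iform Y q x \<Longrightarrow> iform Y r z \<le> iform Y q z"
    using z unfolding mem_hpoly_order_forms by auto
  define h where "h t = g (lerp Y t x z) - iform Y p (lerp Y t x z)" for t
  have h: "continuous_on {0..1} h"
    unfolding h_def iform_lerp
    using continuous_on_segment[OF x zc] F(2) unfolding piecewise_in_def
    by (intro continuous_intros) auto
  define E where "E = insert 1 ((\<lambda>q. \<bar>iform Y q x - iform Y p x\<bar>) ` {q\<in>F. iform Y q x \<noteq> iform Y p x})"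
  define \<delta> where "\<delta> = Min E"
  \<comment> \<open>The element \<open>1\<close> only keeps \<open>E\<close> nonempty when all forms agree at \<open>x\<close>.\<close>
  have E: "finite E" "E \<noteq> {}" using F(1) by (auto simp: E_def)
  have "\<delta> > 0" unfolding \<delta>_def using E by (simp add: E_def)
  have gap: "h t = 0 \<or> \<bar>h t\<bar> \<ge> (1 - t) * \<delta>" if t: "0 \<le> t" "t \<le> 1" for t
  proof -
    obtain q where q: "q \<in> F" "g (lerp Y t x z) = iform Y q (lerp Y t x z)"
      using F(2) lerp_cube[OF x zc t] unfolding piecewise_in_def by blast
    have ht: "h t = (1 - t) * (iform Y q x - iform Y p x) + t * (iform Y q z - iform Y p z)"
      unfolding h_def q(2) iform_lerp by (simp add: algebra_simps)
    have \<delta>: "\<delta> \<le> \<bar>iform Y q x - iform Y p x\<bar>" if "iform Y q x \<noteq> iform Y p x"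
      unfolding \<delta>_def using E q(1) that by (intro Min_le) (auto simp: E_def)
    consider "iform Y q x = iform Y p x" | "iform Y q x > iform Y p x" | "iform Y q x < iform Y p x"
      by linarith
    then show ?thesis
    proof cases
      case 1
      then have "iform Y q z = iform Y p z"
        using ord[OF p(1) q(1)] ord[OF q(1) p(1)] by simp
      then show ?thesis using 1 ht by simp
    next
      case 2
      then have "0 \<le> t * (iform Y q z - iform Y p z)"
        using ord[OF q(1) p(1)] t by simp
      moreover have "(1 - t) * \<delta> \<le> (1 - t) * (iform Y q x - iform Y p x)"
        using 2 \<delta> t by (intro mult_left_mono) auto
      ultimately show ?thesis unfolding ht by linarith
    next
      case 3
      then have "0 \<le> t * (iform Y p z - iform Y q z)"
        using ord[OF p(1) q(1)] t by simp
      moreover have "(1 - t) * \<delta> \<le> (1 - t) * (iform Y p x - iform Y q x)"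
        using 3 \<delta> t by (intro mult_left_mono) auto
      ultimately show ?thesis unfolding ht by (simp add: right_diff_distrib) linarith
    qed
  qed
  have h0: "h 0 = 0"
  proof -
    have "lerp Y 0 x z = x"
      using cube_extensional[OF x] by (intro extensionalityI[of _ Y]) (auto simp: lerp_def)
    then show ?thesis using p(2) by (simp add: h_def)
  qed
  have zero: "h t = 0" if t: "0 \<le> t" "t < 1" for t
  proof (rule ccontr)
    assume "h t \<noteq> 0"
    then have "\<bar>h t\<bar> \<ge> (1 - t) * \<delta>" using gap t by force
    moreover have "(1 - t) * \<delta> > 0" using t \<open>\<delta> > 0\<close> by simp
    ultimately have "0 \<le> \<bar>h t\<bar> - (1 - t) * \<delta> / 2" by linarith
    moreover have "\<bar>h 0\<bar> - (1 - 0) * \<delta> / 2 \<le> 0" using h0 \<open>\<delta> > 0\<close> by simp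
    moreover have "continuous_on {0..t} (\<lambda>s. \<bar>h s\<bar> - (1 - s) * \<delta> / 2)"
      by (intro continuous_intros continuous_on_subset[OF h]) (use t in auto)
    ultimately obtain s where s: "0 \<le> s" "s \<le> t" "\<bar>h s\<bar> - (1 - s) * \<delta> / 2 = 0"
      using IVT'[of "\<lambda>s. \<bar>h s\<bar> - (1 - s) * \<delta> / 2" 0 0 t] t by blast
    moreover have "(1 - s) * \<delta> > 0" using s t \<open>\<delta> > 0\<close> by simp
    ultimately show False using gap[of s] t by auto
  qed
  have "h 1 = 0"
    by (rule continuous_constant_on_closure[of "{0..<1}" h]) (use h zero in auto)
  moreover have "lerp Y 1 x z = z"
    using cube_extensional[OF zc] by (intro extensionalityI[of _ Y]) (auto simp: lerp_def)
  ultimately show ?thesis by (simp add: h_def)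
qed

text \<open>On each cell the zeros of \<open>g\<close> are cut out by the two inequalities \<open>p \<ge> 0\<close> and \<open>- p \<ge> 0\<close> for
  the form \<open>p\<close> that represents \<open>g\<close> there.\<close>

lemma rational_polyhedron_zero_set:
  assumes Y: "finite Y" and g: "finite_mcnaughton Y g"
  shows "rational_polyhedron Y {x \<in> cube Y. g x = 0}"
proof -
  obtain F where F: "finite F" "piecewise_in Y F g"
    using finite_mcnaughton_piecewise_in[OF g] by blast
  define Z where "Z = {(x, p) | x p. x \<in> cube Y \<and> g x = 0 \<and> p \<in> F \<and> g x = iform Y p x}"
  let ?neg = "\<lambda>p. form_diff ((\<lambda>_. 0), 0) p"
  let ?C = "\<lambda>(x, p). order_forms Y F x \<union> {p, ?neg p}"
  have neg: "iform Y (?neg p) x = - iform Y p x" for p x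
    by (simp add: iform_diff) (simp add: iform_def)
  have "?C ` Z \<subseteq> (\<lambda>(C, p). C \<union> {p, ?neg p}) ` (range (order_forms Y F) \<times> F)"
    unfolding Z_def by auto
  then have fin: "finite (?C ` Z)"
    using finite_range_order_forms[OF F(1)] F(1) by (rule_tac finite_subset) auto
  have "rational_polyhedron Y (\<Union>(hpoly Y ` ?C ` Z))"
  proof (rule rational_polyhedron_Union)
    show "finite (hpoly Y ` ?C ` Z)" using fin by (rule finite_imageI)
    fix P assume "P \<in> hpoly Y ` ?C ` Z"
    then obtain x p where "P = hpoly Y (?C (x, p))" by auto
    then show "rational_polyhedron Y P"
      using rational_polyhedron_hpoly[OF Y] finite_order_forms[OF F(1)] by simp
  qed
  moreover have "\<Union>(hpoly Y ` ?C ` Z) = {x \<in> cube Y. g x = 0}"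
  proof
    show "\<Union>(hpoly Y ` ?C ` Z) \<subseteq> {x \<in> cube Y. g x = 0}"
    proof
      fix z assume "z \<in> \<Union>(hpoly Y ` ?C ` Z)"
      then obtain x p where x: "x \<in> cube Y" "p \<in> F" "g x = iform Y p x" and z: "z \<in> hpoly Y (?C (x, p))"
        unfolding Z_def by auto
      have "z \<in> hpoly Y (order_forms Y F x)" "iform Y p z = 0"
        using z neg by (auto simp: hpoly_def intro: antisym)
      then show "z \<in> {x \<in> cube Y. g x = 0}"
        using piecewise_in_affine_on_cell[OF F x(1) _ x(2,3)] by (auto simp: hpoly_def)
    qed
    show "{x \<in> cube Y. g x = 0} \<subseteq> \<Union>(hpoly Y ` ?C ` Z)"
    proof
      fix x assume x: "x \<in> {x \<in> cube Y. g x = 0}"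
      then obtain p where p: "p \<in> F" "g x = iform Y p x"
        using F(2) unfolding piecewise_in_def by blast
      have "x \<in> hpoly Y (order_forms Y F x)"
        using x by (simp add: mem_hpoly_order_forms)
      then have "x \<in> hpoly Y (?C (x, p))"
        using x p neg by (auto simp: hpoly_def)
      moreover have "(x, p) \<in> Z"
        unfolding Z_def using x p by (intro CollectI exI[of _ x] exI[of _ p]) simp
      ultimately show "x \<in> \<Union>(hpoly Y ` ?C ` Z)"
        by (intro UnionI[of "hpoly Y (?C (x, p))"] imageI)
    qed
  qed
  ultimately show ?thesis by simp
qed

text \<open>Both functions are affine, so it suffices to compare them at the finitely many vertices. At a
  vertex where \<open>b\<close> vanishes so does \<open>a\<close>, and elsewhere \<open>b\<close> is positive.\<close>

lemma dominated_on_polytope: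
  assumes Y: "finite Y" and C: "finite C"
    and a: "\<And>z. z \<in> hpoly Y C \<Longrightarrow> a z = iform Y p z" and b: "\<And>z. z \<in> hpoly Y C \<Longrightarrow> b z = iform Y q z"
    and nonneg: "\<And>z. z \<in> hpoly Y C \<Longrightarrow> 0 \<le> b z"
    and zero: "\<And>z. z \<in> hpoly Y C \<Longrightarrow> b z = 0 \<Longrightarrow> a z = 0"
  shows "\<exists>n::nat. \<forall>z\<in>hpoly Y C. a z \<le> n * b z"
proof -
  obtain V where V: "finite V" "V \<subseteq> hpoly Y C" "hpoly Y C = convex_envelope Y V"
    using hpoly_vertices[OF Y C] by metis
  have "\<exists>n::nat. a v \<le> n * b v" if "v \<in> V" for v
  proof (cases "b v = 0")
    case True
    then show ?thesis using zero V(2) that by auto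
  next
    case False
    then have "b v > 0" using nonneg V(2) that by force
    then show ?thesis using reals_Archimedean3 less_imp_le by metis
  qed
  then obtain N :: "('a \<Rightarrow> real) \<Rightarrow> nat" where N: "\<And>v. v \<in> V \<Longrightarrow> a v \<le> N v * b v" by metis
  define n where "n = (\<Sum>v\<in>V. N v)"
  have n: "a v \<le> n * b v" if "v \<in> V" for v
  proof -
    have "N v \<le> n" unfolding n_def using V(1) that by (intro member_le_sum) auto
    then have "N v * b v \<le> n * b v" using nonneg V(2) that by (intro mult_right_mono) auto
    then show ?thesis using N[OF that] by linarith
  qed
  have "a z \<le> n * b z" if z: "z \<in> hpoly Y C" for z
  proof -
    obtain c where c: "\<forall>v\<in>V. 0 \<le> c v" "(\<Sum>v\<in>V. c v) = 1" "z = (\<lambda>y\<in>Y. \<Sum>v\<in>V. c v * v y)"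
      using z unfolding V(3) convex_envelope_def by blast
    have az: "a z = (\<Sum>v\<in>V. c v * a v)"
      unfolding a[OF z] unfolding c(3) iform_convex_combination[OF c(2)]
      using V(2) a by (intro sum.cong) auto
    have bz: "b z = (\<Sum>v\<in>V. c v * b v)"
      unfolding b[OF z] unfolding c(3) iform_convex_combination[OF c(2)]
      using V(2) b by (intro sum.cong) auto
    have "(\<Sum>v\<in>V. c v * a v) \<le> (\<Sum>v\<in>V. c v * (n * b v))"
      using c(1) n by (intro sum_mono mult_left_mono) auto
    then show ?thesis unfolding az bz by (simp add: sum_distrib_left mult_ac)
  qed
  then show ?thesis by blast
qed

lemma finite_mcnaughton_dominated:
  assumes Y: "finite Y" and ab: "finite_mcnaughton Y a" "finite_mcnaughton Y b"
    and zero: "\<And>z. z \<in> cube Y \<Longrightarrow> b z = 0 \<Longrightarrow> a z = 0"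
  shows "\<exists>n::nat. \<forall>z\<in>cube Y. a z \<le> n * b z"
proof -
  obtain F G where "finite F" "piecewise_in Y F a" "finite G" "piecewise_in Y G b"
    using finite_mcnaughton_piecewise_in ab by metis
  then obtain H where H: "finite H" "piecewise_in Y H a" "piecewise_in Y H b"
    using piecewise_in_mono[of Y _ _ "F \<union> G"] by (metis Un_upper1 Un_upper2 finite_UnI)
  define \<K> where "\<K> = order_forms Y H ` cube Y"
  have "finite \<K>"
    unfolding \<K>_def by (rule finite_subset[OF _ finite_range_order_forms[OF H(1), of Y]]) auto
  have "\<exists>n::nat. \<forall>z\<in>hpoly Y C. a z \<le> n * b z" if C: "C \<in> \<K>" for C
  proof -
    obtain x where x: "x \<in> cube Y" "C = order_forms Y H x" using C unfolding \<K>_def by blast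
    obtain p q where p: "p \<in> H" "a x = iform Y p x" and q: "q \<in> H" "b x = iform Y q x"
      using H(2,3) x(1) unfolding piecewise_in_def by metis
    show ?thesis unfolding x(2)
    proof (rule dominated_on_polytope[OF Y finite_order_forms[OF H(1)]])
      fix z assume z: "z \<in> hpoly Y (order_forms Y H x)"
      then have zc: "z \<in> cube Y" by (simp add: hpoly_def)
      show "a z = iform Y p z" by (rule piecewise_in_affine_on_cell[OF H(1,2) x(1) z p])
      show "b z = iform Y q z" by (rule piecewise_in_affine_on_cell[OF H(1,3) x(1) z q])
      show "0 \<le> b z" using ab(2) zc unfolding finite_mcnaughton_def by auto
      show "a z = 0" if "b z = 0" using zero zc that by blast
    qed
  qed
  then obtain N :: "_ \<Rightarrow> nat" where N: "\<And>C z. C \<in> \<K> \<Longrightarrow> z \<in> hpoly Y C \<Longrightarrow> a z \<le> N C * b z" by metis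
  have "a z \<le> (\<Sum>C\<in>\<K>. N C) * b z" if z: "z \<in> cube Y" for z
  proof -
    have C: "order_forms Y H z \<in> \<K>" using z unfolding \<K>_def by blast
    have "z \<in> hpoly Y (order_forms Y H z)" using z by (simp add: mem_hpoly_order_forms)
    then have "a z \<le> N (order_forms Y H z) * b z" using N C by blast
    also have "\<dots> \<le> (\<Sum>C\<in>\<K>. N C) * b z"
    proof (rule mult_right_mono)
      show "real (N (order_forms Y H z)) \<le> (\<Sum>C\<in>\<K>. N C)"
        using \<open>finite \<K>\<close> C unfolding of_nat_le_iff by (intro member_le_sum) auto
      show "0 \<le> b z" using ab(2) z unfolding finite_mcnaughton_def by auto
    qed
    finally show ?thesis .
  qed
  then show ?thesis by blast
qed

section \<open>Zero sets of McNaughton functions\<close>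

definition zero_set :: "'k set \<Rightarrow> (('k \<Rightarrow> real) \<Rightarrow> real) \<Rightarrow> ('k \<Rightarrow> real) set" where
  "zero_set X f = {x \<in> cube X. f x = 0}"

lemma mcnaughton_cases:
  assumes "f \<in> mcnaughton X"
  obtains Y g where "finite Y" "Y \<subseteq> X" "finite_mcnaughton Y g" "f = (\<lambda>x\<in>cube X. g (restrict x Y))"
  using assms unfolding mcnaughton_def by blast

lemma cube_extend:
  assumes "Y \<subseteq> X" "z \<in> cube Y"
  shows "\<exists>x\<in>cube X. restrict x Y = z"
proof -
  let ?x = "\<lambda>y\<in>X. if y \<in> Y then z y else 0"
  have "?x \<in> cube X" using assms(2) by (auto simp: cube_def PiE_def Pi_def)
  moreover have "restrict ?x Y = z"
    using assms cube_extensional[OF assms(2)] by (intro extensionalityI[of _ Y]) auto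
  ultimately show ?thesis by blast
qed

text \<open>The Nullstellensatz for McNaughton functions: if \<open>a\<close> vanishes wherever \<open>b\<close> does, then a
  multiple of \<open>b\<close> bounds \<open>a\<close>. Only finitely many coordinates matter, and every point of the
  finite-dimensional cube extends to a point of \<open>cube X\<close>.\<close>

lemma mcnaughton_dominated:
  assumes ab: "a \<in> mcnaughton X" "b \<in> mcnaughton X" and zero: "zero_set X b \<subseteq> zero_set X a"
  shows "\<exists>n::nat. \<forall>x\<in>cube X. a x \<le> n * b x"
proof -
  obtain Y g where Y: "finite Y" "Y \<subseteq> X" "finite_mcnaughton Y g" "a = (\<lambda>x\<in>cube X. g (restrict x Y))"
    using mcnaughton_cases[OF ab(1)] by blast
  obtain Z h where Z: "finite Z" "Z \<subseteq> X" "finite_mcnaughton Z h" "b = (\<lambda>x\<in>cube X. h (restrict x Z))"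
    using mcnaughton_cases[OF ab(2)] by blast
  let ?g = "\<lambda>x. g (restrict x Y)" and ?h = "\<lambda>x. h (restrict x Z)"
  have fin: "finite (Y \<union> Z)" using Y(1) Z(1) by simp
  have g: "a x = ?g (restrict x (Y \<union> Z))" and h: "b x = ?h (restrict x (Y \<union> Z))" if "x \<in> cube X" for x
    using that by (simp_all add: Y(4) Z(4) Int_absorb1)
  have "\<exists>n::nat. \<forall>z\<in>cube (Y \<union> Z). ?g z \<le> n * ?h z"
  proof (rule finite_mcnaughton_dominated[OF fin])
    show "finite_mcnaughton (Y \<union> Z) ?g" by (rule finite_mcnaughton_mono[OF Y(3) _ fin]) simp
    show "finite_mcnaughton (Y \<union> Z) ?h" by (rule finite_mcnaughton_mono[OF Z(3) _ fin]) simp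
    fix z assume z: "z \<in> cube (Y \<union> Z)" "?h z = 0"
    then obtain x where x: "x \<in> cube X" "restrict x (Y \<union> Z) = z"
      using cube_extend Y(2) Z(2) by (metis Un_least)
    then have "b x = 0" using h z(2) by metis
    then have "a x = 0" using zero x(1) by (auto simp: zero_set_def)
    then show "?g z = 0" using g x by metis
  qed
  then obtain n :: nat where n: "\<And>z. z \<in> cube (Y \<union> Z) \<Longrightarrow> ?g z \<le> n * ?h z" by blast
  have "a x \<le> n * b x" if x: "x \<in> cube X" for x
    unfolding g[OF x] h[OF x] using Y(2) Z(2) by (intro n restrict_cube[OF x]) simp
  then show ?thesis by blast
qed

lemma mcnaughton_one: "(\<lambda>x\<in>cube X. 1) \<in> mcnaughton X"
proof -
  have "(\<lambda>x\<in>cube X. 1 - (\<lambda>x\<in>cube X. 0) x) \<in> mcnaughton X"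
    by (rule mcnaughton_neg[OF mcnaughton_zero])
  then show ?thesis by (simp cong: restrict_cong)
qed

lemma mcnaughton_max:
  assumes "f \<in> mcnaughton X" "g \<in> mcnaughton X"
  shows "(\<lambda>x\<in>cube X. max (f x) (g x)) \<in> mcnaughton X"
proof -
  have "max (f x) (g x) = min 1 (1 - min 1 (1 - f x + g x) + g x)" if "x \<in> cube X" for x
    using mcnaughton_bounds[OF assms(1) that] mcnaughton_bounds[OF assms(2) that] by linarith
  then show ?thesis
    using mcnaughton_add[OF mcnaughton_neg[OF mcnaughton_add[OF mcnaughton_neg[OF assms(1)] assms(2)]] assms(2)]
    by (simp cong: restrict_cong)
qed

lemma mcnaughton_min:
  assumes "f \<in> mcnaughton X" "g \<in> mcnaughton X"
  shows "(\<lambda>x\<in>cube X. min (f x) (g x)) \<in> mcnaughton X"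
proof -
  have "min (f x) (g x) = 1 - max (1 - f x) (1 - g x)" for x by linarith
  then show ?thesis
    using mcnaughton_neg[OF mcnaughton_max[OF mcnaughton_neg[OF assms(1)] mcnaughton_neg[OF assms(2)]]]
    by (simp cong: restrict_cong)
qed

lemma zero_set_add:
  assumes "f \<in> mcnaughton X" "g \<in> mcnaughton X"
  shows "zero_set X (\<lambda>x\<in>cube X. min 1 (f x + g x)) = zero_set X f \<inter> zero_set X g"
proof -
  have "min 1 (f x + g x) = 0 \<longleftrightarrow> f x = 0 \<and> g x = 0" if "x \<in> cube X" for x
    using mcnaughton_bounds[OF assms(1) that] mcnaughton_bounds[OF assms(2) that] by linarith
  then show ?thesis by (auto simp: zero_set_def)
qed

lemma zero_set_min:
  assumes "f \<in> mcnaughton X" "g \<in> mcnaughton X"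
  shows "zero_set X (\<lambda>x\<in>cube X. min (f x) (g x)) = zero_set X f \<union> zero_set X g"
proof -
  have "min (f x) (g x) = 0 \<longleftrightarrow> f x = 0 \<or> g x = 0" if "x \<in> cube X" for x
    using mcnaughton_bounds[OF assms(1) that] mcnaughton_bounds[OF assms(2) that] by linarith
  then show ?thesis by (auto simp: zero_set_def)
qed

lemma mcnaughton_truncated_form:
  assumes Y: "finite Y" "Y \<subseteq> X"
  shows "(\<lambda>x\<in>cube X. max 0 (min 1 (iform Y p (restrict x Y)))) \<in> mcnaughton X"
proof -
  let ?g = "\<lambda>z. max 0 (min 1 (iform Y p z))"
  have proj: "continuous_map (cube_topology Y) euclideanreal (\<lambda>z. z y)" if "y \<in> Y" for y
    using continuous_map_product_projection[OF that, of "\<lambda>_. top_of_set {0..1::real}"]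
    unfolding cube_topology_def by (simp add: continuous_map_in_subtopology)
  have "continuous_map (cube_topology Y) euclideanreal (iform Y p)"
    unfolding iform_def using Y(1) proj
    by (intro continuous_map_add continuous_map_sum continuous_map_real_mult) auto
  then have cont: "continuous_map (cube_topology Y) euclideanreal ?g"
    by (intro continuous_map_real_max continuous_map_real_min) auto
  let ?F = "{((\<lambda>_. 0), 0), ((\<lambda>_. 0), 1), p}"
  have "\<exists>(c, d)\<in>?F. ?g z = (\<Sum>y\<in>Y. of_int (c y) * z y) + of_int d" for z
  proof -
    have "?g z = 0 \<or> ?g z = 1 \<or> ?g z = iform Y p z" by linarith
    then show ?thesis by (auto simp: iform_def case_prod_beta)
  qed
  then have "finite_mcnaughton Y ?g"
    unfolding finite_mcnaughton_def using cont by (intro conjI exI[of _ ?F]) auto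
  then show ?thesis
    unfolding mcnaughton_def using Y by blast
qed

text \<open>The inequality \<open>p \<ge> 0\<close> defines the zero set of the truncation of \<open>- p\<close> to \<open>{0..1}\<close>; several
  inequalities are combined by truncated addition.\<close>

lemma hpoly_cylinder_zero_set:
  assumes Y: "finite Y" "Y \<subseteq> X" and C: "finite C"
  shows "\<exists>f\<in>mcnaughton X. zero_set X f = {x \<in> cube X. restrict x Y \<in> hpoly Y C}"
  using C
proof (induction C rule: finite_induct)
  case empty
  have "zero_set X (\<lambda>x\<in>cube X. 0) = {x \<in> cube X. restrict x Y \<in> hpoly Y {}}"
    using restrict_cube[OF _ Y(2)] by (auto simp: zero_set_def hpoly_def)
  then show ?case using mcnaughton_zero by blast
next
  case (insert p C)
  then obtain f where f: "f \<in> mcnaughton X" "zero_set X f = {x \<in> cube X. restrict x Y \<in> hpoly Y C}" by blast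
  let ?n = "form_diff ((\<lambda>_. 0), 0) p"
  let ?h = "\<lambda>x\<in>cube X. max 0 (min 1 (iform Y ?n (restrict x Y)))"
  have n: "iform Y ?n x = - iform Y p x" for x
    by (simp add: iform_diff) (simp add: iform_def)
  have h: "?h \<in> mcnaughton X" by (rule mcnaughton_truncated_form[OF Y])
  have "max 0 (min 1 (- r)) = 0 \<longleftrightarrow> 0 \<le> r" for r :: real by linarith
  then have "zero_set X ?h = {x \<in> cube X. 0 \<le> iform Y p (restrict x Y)}"
    by (auto simp: zero_set_def n)
  then have "zero_set X f \<inter> zero_set X ?h = {x \<in> cube X. restrict x Y \<in> hpoly Y (insert p C)}"
    unfolding f(2) hpoly_def by blast
  then show ?case
    using zero_set_add[OF f(1) h] mcnaughton_add[OF f(1) h] by (metis (no_types, lifting))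
qed

text \<open>Zero sets are polyhedra because McNaughton functions are affine on rational polytopes.
  Conversely, a rational simplex is cut out by integral inequalities, hence is a zero set, and
  finite unions of zero sets are zero sets of pointwise minima.\<close>

lemma cylinder_rational_polyhedra_eq: "cylinder_rational_polyhedra X = zero_set X ` mcnaughton X"
proof
  show "zero_set X ` mcnaughton X \<subseteq> cylinder_rational_polyhedra X"
  proof
    fix Q assume "Q \<in> zero_set X ` mcnaughton X"
    then obtain f where f: "f \<in> mcnaughton X" "Q = zero_set X f" by blast
    obtain Y g where Y: "finite Y" "Y \<subseteq> X" "finite_mcnaughton Y g" "f = (\<lambda>x\<in>cube X. g (restrict x Y))"
      using mcnaughton_cases[OF f(1)] by blast
    have "Q = {x \<in> cube X. restrict x Y \<in> {z \<in> cube Y. g z = 0}}"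
      using restrict_cube[OF _ Y(2)] unfolding f(2) zero_set_def Y(4) by auto
    then show "Q \<in> cylinder_rational_polyhedra X"
      using Y(1,2) rational_polyhedron_zero_set[OF Y(1,3)] unfolding cylinder_rational_polyhedra_def by blast
  qed
  show "cylinder_rational_polyhedra X \<subseteq> zero_set X ` mcnaughton X"
  proof
    fix Q assume "Q \<in> cylinder_rational_polyhedra X"
    then obtain Y P where Y: "finite Y" "Y \<subseteq> X" and P: "rational_polyhedron Y P"
      and Q: "Q = {x \<in> cube X. restrict x Y \<in> P}"
      unfolding cylinder_rational_polyhedra_def by blast
    obtain \<S> where \<S>: "finite \<S>" "\<forall>S\<in>\<S>. rational_simplex Y S" "P = \<Union>\<S>"
      using P unfolding rational_polyhedron_def by blast
    have "\<exists>f\<in>mcnaughton X. zero_set X f = {x \<in> cube X. restrict x Y \<in> \<Union>\<S>}"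
      using \<S>(1,2)
    proof (induction \<S> rule: finite_induct)
      case empty
      have "zero_set X (\<lambda>x\<in>cube X. 1) = {}" by (auto simp: zero_set_def)
      then show ?case using mcnaughton_one by auto
    next
      case (insert S \<S>)
      have "\<forall>S\<in>\<S>. rational_simplex Y S" using insert.prems by simp
      then obtain f where f: "f \<in> mcnaughton X" "zero_set X f = {x \<in> cube X. restrict x Y \<in> \<Union>\<S>}"
        using insert.IH by blast
      obtain V where V: "finite V" "V \<subseteq> cube Y" "\<forall>v\<in>V. \<forall>y\<in>Y. v y \<in> \<rat>" "S = convex_envelope Y V"
        using insert.prems unfolding rational_simplex_def by auto
      obtain C where C: "finite C" "S = hpoly Y C"
        using convex_envelope_eq_hpoly[OF Y(1) V(1-3)] V(4) by blast
      obtain h where h: "h \<in> mcnaughton X" "zero_set X h = {x \<in> cube X. restrict x Y \<in> S}"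
        using hpoly_cylinder_zero_set[OF Y C(1)] C(2) by blast
      have "zero_set X h \<union> zero_set X f = {x \<in> cube X. restrict x Y \<in> \<Union>(insert S \<S>)}"
        unfolding f(2) h(2) by blast
      then show ?case
        using zero_set_min[OF h(1) f(1)] mcnaughton_min[OF h(1) f(1)] by (metis (no_types, lifting))
    qed
    then show "Q \<in> zero_set X ` mcnaughton X" unfolding Q \<S>(3) by (metis image_eqI)
  qed
qed

section \<open>Ideals of McNaughton functions\<close>

lemma carrier_free_mv [simp]: "carrier (free_mv X) = mcnaughton X"
  by (simp add: free_mv_def)

lemma mv_sup_free_mv:
  assumes "f \<in> mcnaughton X" "g \<in> mcnaughton X"
  shows "mv_sup (free_mv X) f g = (\<lambda>x\<in>cube X. max (f x) (g x))"
proof -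
  have "max (f x) (g x) = min 1 (1 - min 1 (1 - f x + g x) + g x)" if "x \<in> cube X" for x
    using mcnaughton_bounds[OF assms(1) that] mcnaughton_bounds[OF assms(2) that] by linarith
  then show ?thesis by (simp add: mv_sup_def free_mv_def cong: restrict_cong)
qed

lemma mv_inf_free_mv:
  assumes "f \<in> mcnaughton X" "g \<in> mcnaughton X"
  shows "mv_inf (free_mv X) f g = (\<lambda>x\<in>cube X. min (f x) (g x))"
proof -
  have neg: "mv_neg (free_mv X) h = (\<lambda>x\<in>cube X. 1 - h x)" for h
    by (simp add: free_mv_def)
  have "min (f x) (g x) = 1 - max (1 - f x) (1 - g x)" for x by linarith
  then show ?thesis
    unfolding mv_inf_def neg mv_sup_free_mv[OF mcnaughton_neg[OF assms(1)] mcnaughton_neg[OF assms(2)]]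
    by (simp cong: restrict_cong)
qed

lemma mv_le_free_mv:
  assumes "f \<in> mcnaughton X" "g \<in> mcnaughton X"
  shows "mv_le (free_mv X) f g \<longleftrightarrow> (\<forall>x\<in>cube X. f x \<le> g x)"
proof
  assume "mv_le (free_mv X) f g"
  then have "(\<lambda>x\<in>cube X. max (f x) (g x)) = g"
    unfolding mv_le_def mv_sup_free_mv[OF assms] .
  then show "\<forall>x\<in>cube X. f x \<le> g x"
    by (metis max.cobounded1 restrict_apply')
next
  assume "\<forall>x\<in>cube X. f x \<le> g x"
  then show "mv_le (free_mv X) f g"
    unfolding mv_le_def mv_sup_free_mv[OF assms] by (intro mcnaughton_eqI[OF assms(2)]) auto
qed

lemma mv_ideal_free_mv:
  "mv_ideal (free_mv X) I \<longleftrightarrow>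
     I \<subseteq> mcnaughton X \<and> I \<noteq> {} \<and>
     (\<forall>f\<in>mcnaughton X. \<forall>g\<in>I. (\<forall>x\<in>cube X. f x \<le> g x) \<longrightarrow> f \<in> I) \<and>
     (\<forall>f\<in>I. \<forall>g\<in>I. (\<lambda>x\<in>cube X. min 1 (f x + g x)) \<in> I)"
proof -
  have add: "mv_add (free_mv X) f g = (\<lambda>x\<in>cube X. min 1 (f x + g x))" for f g
    by (simp add: free_mv_def)
  have "(\<forall>f\<in>mcnaughton X. \<forall>g\<in>I. mv_le (free_mv X) f g \<longrightarrow> f \<in> I) \<longleftrightarrow>
      (\<forall>f\<in>mcnaughton X. \<forall>g\<in>I. (\<forall>x\<in>cube X. f x \<le> g x) \<longrightarrow> f \<in> I)" if "I \<subseteq> mcnaughton X"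
    using that by (intro ball_cong refl) (simp add: mv_le_free_mv subset_iff)
  then show ?thesis
    by (cases "I \<subseteq> mcnaughton X") (simp_all add: mv_ideal_def add)
qed

lemma ideal_subset: "mv_ideal (free_mv X) I \<Longrightarrow> f \<in> I \<Longrightarrow> f \<in> mcnaughton X"
  unfolding mv_ideal_free_mv by blast

lemma ideal_down:
  assumes "mv_ideal (free_mv X) I" "g \<in> I" "f \<in> mcnaughton X" "\<And>x. x \<in> cube X \<Longrightarrow> f x \<le> g x"
  shows "f \<in> I"
  using assms unfolding mv_ideal_free_mv by blast

lemma ideal_add: "mv_ideal (free_mv X) I \<Longrightarrow> f \<in> I \<Longrightarrow> g \<in> I \<Longrightarrow> (\<lambda>x\<in>cube X. min 1 (f x + g x)) \<in> I"
  unfolding mv_ideal_free_mv by blast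

lemma ideal_zero:
  assumes "mv_ideal (free_mv X) I"
  shows "(\<lambda>x\<in>cube X. 0) \<in> I"
proof -
  obtain g where "g \<in> I" using assms unfolding mv_ideal_free_mv by blast
  then show ?thesis
    using ideal_down[OF assms _ mcnaughton_zero] mcnaughton_bounds(1)[OF ideal_subset[OF assms]] by fastforce
qed

lemma mv_ideal_mcnaughton: "mv_ideal (free_mv X) (mcnaughton X)"
  unfolding mv_ideal_free_mv using mcnaughton_add mcnaughton_zero by blast

lemma sum_nonneg_mcnaughton: "T \<subseteq> mcnaughton X \<Longrightarrow> x \<in> cube X \<Longrightarrow> 0 \<le> (\<Sum>f\<in>T. f x)"
  by (intro sum_nonneg) (auto intro: mcnaughton_bounds)

lemma ideal_truncated_sum:
  assumes I: "mv_ideal (free_mv X) I" and T: "finite T" "T \<subseteq> I"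
  shows "(\<lambda>x\<in>cube X. min 1 (\<Sum>f\<in>T. f x)) \<in> I"
  using T
proof (induction T rule: finite_induct)
  case (insert f T)
  have "min 1 (f x + min 1 (\<Sum>f\<in>T. f x)) = min 1 (\<Sum>f\<in>insert f T. f x)" if "x \<in> cube X" for x
    using mcnaughton_bounds(1)[OF ideal_subset[OF I] that, of f] insert by simp
  then have "(\<lambda>x\<in>cube X. min 1 (f x + (\<lambda>x\<in>cube X. min 1 (\<Sum>f\<in>T. f x)) x)) =
      (\<lambda>x\<in>cube X. min 1 (\<Sum>f\<in>insert f T. f x))"
    by (intro restrict_ext) simp
  moreover have f: "f \<in> I" and T: "(\<lambda>x\<in>cube X. min 1 (\<Sum>f\<in>T. f x)) \<in> I"
    using insert.IH insert.prems by blast+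
  ultimately show ?case
    using ideal_add[OF I f T] by (simp only:)
qed (use ideal_zero[OF I] in simp)

lemma ideal_truncated_multiple:
  assumes I: "mv_ideal (free_mv X) I" and f: "f \<in> I"
  shows "(\<lambda>x\<in>cube X. min 1 (real n * f x)) \<in> I"
proof (induction n)
  case 0
  have "(\<lambda>x\<in>cube X. min 1 (real 0 * f x)) = (\<lambda>x\<in>cube X. 0)"
    by (intro restrict_ext) simp
  then show ?case
    using ideal_zero[OF I] by (simp only:)
next
  case (Suc n)
  have "min 1 (f x + min 1 (real n * f x)) = min 1 (real (Suc n) * f x)" if "x \<in> cube X" for x
    using mcnaughton_bounds(1)[OF ideal_subset[OF I f] that] by (simp add: algebra_simps)
  then have "(\<lambda>x\<in>cube X. min 1 (f x + (\<lambda>x\<in>cube X. min 1 (real n * f x)) x)) =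
      (\<lambda>x\<in>cube X. min 1 (real (Suc n) * f x))"
    by (intro restrict_ext) simp
  then show ?case
    using ideal_add[OF I f Suc] by (simp only:)
qed

text \<open>Membership in an ideal can be tested by real inequalities: since \<open>f \<le> 1\<close>, it does no
  harm that the sums available in the ideal are truncated at \<open>1\<close>.\<close>

lemma ideal_dominated:
  assumes I: "mv_ideal (free_mv X) I" and T: "finite T" "T \<subseteq> I"
    and f: "f \<in> mcnaughton X" "\<And>x. x \<in> cube X \<Longrightarrow> f x \<le> real n * (\<Sum>g\<in>T. g x)"
  shows "f \<in> I"
proof (rule ideal_down[OF I ideal_truncated_multiple[OF I ideal_truncated_sum[OF I T], of "Suc n"] f(1)])
  fix x assume x: "x \<in> cube X"
  define S where "S = (\<Sum>g\<in>T. g x)"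
  have "0 \<le> S" unfolding S_def using sum_nonneg_mcnaughton x T(2) ideal_subset[OF I] by blast
  have "f x \<le> 1" "f x \<le> n * S" using mcnaughton_bounds(2)[OF f(1) x] f(2)[OF x] by (auto simp: S_def)
  moreover have "real n * S \<le> real (Suc n) * S" using \<open>0 \<le> S\<close> by (simp add: algebra_simps)
  \<comment> \<open>With \<open>n + 1\<close> in place of \<open>n\<close>, the case \<open>S > 1\<close> is settled by \<open>f x \<le> 1\<close> for all \<open>n\<close> alike.\<close>
  moreover have "1 \<le> real (Suc n) * 1" by simp
  ultimately have "f x \<le> min 1 (real (Suc n) * min 1 S)"
    by (cases "S \<le> 1") (simp_all add: min_def)
  then show "f x \<le> (\<lambda>x\<in>cube X. min 1 (real (Suc n) * (\<lambda>x\<in>cube X. min 1 (\<Sum>g\<in>T. g x)) x)) x"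
    using x by (simp add: S_def)
qed

definition generated_ideal :: "'k set \<Rightarrow> (('k \<Rightarrow> real) \<Rightarrow> real) set \<Rightarrow> (('k \<Rightarrow> real) \<Rightarrow> real) set" where
  "generated_ideal X S = {f \<in> mcnaughton X.
     \<exists>T n. finite T \<and> T \<subseteq> S \<and> (\<forall>x\<in>cube X. f x \<le> real n * (\<Sum>g\<in>T. g x))}"

lemma generated_ideal_superset:
  assumes "S \<subseteq> mcnaughton X"
  shows "S \<subseteq> generated_ideal X S"
proof
  fix f assume "f \<in> S"
  then show "f \<in> generated_ideal X S"
    unfolding generated_ideal_def using assms by (intro CollectI conjI exI[of _ "{f}"] exI[of _ 1]) auto
qed

lemma mv_ideal_generated_ideal:
  assumes S: "S \<subseteq> mcnaughton X"
  shows "mv_ideal (free_mv X) (generated_ideal X S)"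
  unfolding mv_ideal_free_mv
proof (intro conjI ballI impI)
  show "generated_ideal X S \<subseteq> mcnaughton X" by (auto simp: generated_ideal_def)
  have "(\<lambda>x\<in>cube X. 0) \<in> generated_ideal X S"
    unfolding generated_ideal_def using mcnaughton_zero by (intro CollectI conjI exI[of _ "{}"]) auto
  then show "generated_ideal X S \<noteq> {}" by blast
next
  fix f g assume "f \<in> mcnaughton X" "g \<in> generated_ideal X S" "\<forall>x\<in>cube X. f x \<le> g x"
  then show "f \<in> generated_ideal X S"
    unfolding generated_ideal_def by (blast intro: order_trans)
next
  fix f g assume "f \<in> generated_ideal X S" "g \<in> generated_ideal X S"
  then obtain T n U m where f: "f \<in> mcnaughton X" "finite T" "T \<subseteq> S" "\<forall>x\<in>cube X. f x \<le> real n * (\<Sum>g\<in>T. g x)"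
    and g: "g \<in> mcnaughton X" "finite U" "U \<subseteq> S" "\<forall>x\<in>cube X. g x \<le> real m * (\<Sum>g\<in>U. g x)"
    unfolding generated_ideal_def by blast
  have "min 1 (f x + g x) \<le> real (n + m) * (\<Sum>g\<in>T \<union> U. g x)" if x: "x \<in> cube X" for x
  proof -
    have nonneg: "0 \<le> h x" if "h \<in> T \<union> U" for h
      using that f(3) g(3) S mcnaughton_bounds(1) x by blast
    have "(\<Sum>g\<in>T. g x) \<le> (\<Sum>g\<in>T \<union> U. g x)" "(\<Sum>g\<in>U. g x) \<le> (\<Sum>g\<in>T \<union> U. g x)"
      using f(2) g(2) nonneg by (auto intro!: sum_mono2)
    then have "real n * (\<Sum>g\<in>T. g x) \<le> real n * (\<Sum>g\<in>T \<union> U. g x)"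
      "real m * (\<Sum>g\<in>U. g x) \<le> real m * (\<Sum>g\<in>T \<union> U. g x)"
      by (auto intro: mult_left_mono)
    moreover have "f x \<le> real n * (\<Sum>g\<in>T. g x)" "g x \<le> real m * (\<Sum>g\<in>U. g x)"
      using f(4) g(4) x by auto
    ultimately show ?thesis by (simp add: distrib_right)
  qed
  then show "(\<lambda>x\<in>cube X. min 1 (f x + g x)) \<in> generated_ideal X S"
    unfolding generated_ideal_def using f g mcnaughton_add
    by (intro CollectI conjI exI[of _ "T \<union> U"] exI[of _ "n + m"]) auto
qed

section \<open>Prime ideals\<close>

lemma mv_prime_ideal_free_mv:
  "mv_prime_ideal (free_mv X) P \<longleftrightarrow> mv_ideal (free_mv X) P \<and> P \<noteq> mcnaughton X \<and>
     (\<forall>f\<in>mcnaughton X. \<forall>g\<in>mcnaughton X. (\<lambda>x\<in>cube X. min (f x) (g x)) \<in> P \<longrightarrow> f \<in> P \<or> g \<in> P)"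
  by (simp add: mv_prime_ideal_def mv_inf_free_mv)

lemma mv_ideal_Union_chain:
  assumes "\<C> \<noteq> {}" "\<And>I. I \<in> \<C> \<Longrightarrow> mv_ideal (free_mv X) I"
    and chain: "\<And>I J. I \<in> \<C> \<Longrightarrow> J \<in> \<C> \<Longrightarrow> I \<subseteq> J \<or> J \<subseteq> I"
  shows "mv_ideal (free_mv X) (\<Union>\<C>)"
  unfolding mv_ideal_free_mv
proof (intro conjI ballI impI)
  show "\<Union>\<C> \<subseteq> mcnaughton X" using assms(2) ideal_subset by blast
  show "\<Union>\<C> \<noteq> {}" using assms(1,2) ideal_zero by blast
next
  fix f g assume "f \<in> mcnaughton X" "g \<in> \<Union>\<C>" "\<forall>x\<in>cube X. f x \<le> g x"
  then show "f \<in> \<Union>\<C>" using assms(2) ideal_down by blast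
next
  fix f g assume "f \<in> \<Union>\<C>" "g \<in> \<Union>\<C>"
  then obtain I J where IJ: "I \<in> \<C>" "J \<in> \<C>" "f \<in> I" "g \<in> J" by blast
  then show "(\<lambda>x\<in>cube X. min 1 (f x + g x)) \<in> \<Union>\<C>"
    using chain[OF IJ(1,2)] assms(2) ideal_add by blast
qed

text \<open>If neither \<open>f\<close> nor \<open>g\<close> were in \<open>M\<close>, maximality would give \<open>a \<le> n (f + s)\<close> and
  \<open>a \<le> m (g + s')\<close> with sums \<open>s\<close>, \<open>s'\<close> of elements of \<open>M\<close>. Pointwise one of \<open>f\<close>, \<open>g\<close> is the minimum,
  so \<open>a\<close> is bounded by a multiple of \<open>min f g + s + s'\<close> and lies in \<open>M\<close>.\<close>

lemma maximal_avoiding_ideal_prime: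
  assumes M: "mv_ideal (free_mv X) M" "a \<notin> M" and a: "a \<in> mcnaughton X"
    and max: "\<And>J. mv_ideal (free_mv X) J \<Longrightarrow> M \<subseteq> J \<Longrightarrow> a \<notin> J \<Longrightarrow> J = M"
  shows "mv_prime_ideal (free_mv X) M"
  unfolding mv_prime_ideal_free_mv
proof (intro conjI ballI impI)
  show "mv_ideal (free_mv X) M" by (rule M)
  show "M \<noteq> mcnaughton X" using M(2) a by blast
  fix f g assume f: "f \<in> mcnaughton X" and g: "g \<in> mcnaughton X"
    and b: "(\<lambda>x\<in>cube X. min (f x) (g x)) \<in> M"
  define b where "b = (\<lambda>x\<in>cube X. min (f x) (g x))"
  have dom: "\<exists>T n. finite T \<and> T \<subseteq> M \<and> (\<forall>x\<in>cube X. a x \<le> real n * (h x + (\<Sum>k\<in>T. k x)))"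
    if h: "h \<in> mcnaughton X" "h \<notin> M" for h
  proof -
    have S: "insert h M \<subseteq> mcnaughton X" using h(1) ideal_subset[OF M(1)] by blast
    have "a \<in> generated_ideal X (insert h M)"
      using max[OF mv_ideal_generated_ideal[OF S]] generated_ideal_superset[OF S] h(2) by blast
    then obtain T and n :: nat where T: "finite T" "T \<subseteq> insert h M" "\<forall>x\<in>cube X. a x \<le> real n * (\<Sum>k\<in>T. k x)"
      unfolding generated_ideal_def by blast
    have "a x \<le> real n * (h x + (\<Sum>k\<in>T - {h}. k x))" if x: "x \<in> cube X" for x
    proof -
      have "(\<Sum>k\<in>T. k x) \<le> h x + (\<Sum>k\<in>T - {h}. k x)"
        using T(1) mcnaughton_bounds(1)[OF h(1) x] by (cases "h \<in> T") (auto simp: sum.remove)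
      then have "real n * (\<Sum>k\<in>T. k x) \<le> real n * (h x + (\<Sum>k\<in>T - {h}. k x))"
        by (rule mult_left_mono) simp
      then show ?thesis using T(3) x by force
    qed
    then show ?thesis using T(1,2) by (intro exI[of _ "T - {h}"] exI[of _ n]) auto
  qed
  show "f \<in> M \<or> g \<in> M"
  proof (rule ccontr)
    assume "\<not> (f \<in> M \<or> g \<in> M)"
    then obtain T n U m where T: "finite T" "T \<subseteq> M" "\<And>x. x \<in> cube X \<Longrightarrow> a x \<le> real n * (f x + (\<Sum>k\<in>T. k x))"
      and U: "finite U" "U \<subseteq> M" "\<And>x. x \<in> cube X \<Longrightarrow> a x \<le> real m * (g x + (\<Sum>k\<in>U. k x))"
      using dom[OF f] dom[OF g] by blast
    \<comment> \<open>A set, so \<open>b\<close> may coincide with a member of \<open>T\<close> or \<open>U\<close>; the factor \<open>2\<close> in the bound below makes up for it.\<close>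
    let ?W = "insert b (T \<union> U)"
    have W: "finite ?W" "?W \<subseteq> M" using T U b by (auto simp: b_def)
    have "a x \<le> real (2 * (n + m)) * (\<Sum>k\<in>?W. k x)" if x: "x \<in> cube X" for x
    proof -
      have nonneg: "0 \<le> k x" if "k \<in> ?W" for k
        using that W(2) ideal_subset[OF M(1)] mcnaughton_bounds(1) x by blast
      have le: "(\<Sum>k\<in>T. k x) \<le> (\<Sum>k\<in>?W. k x)" "(\<Sum>k\<in>U. k x) \<le> (\<Sum>k\<in>?W. k x)"
        "(\<Sum>k\<in>{b}. k x) \<le> (\<Sum>k\<in>?W. k x)"
        using W(1) nonneg by (auto intro!: sum_mono2 simp del: sum.insert sum.insert_if)
      have bx: "b x = min (f x) (g x)" using x by (simp add: b_def)
      define s where "s = (\<Sum>k\<in>?W. k x)"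
      have s: "0 \<le> s" unfolding s_def using nonneg by (rule sum_nonneg)
      have scale: "real l * r \<le> real (2 * (n + m)) * s" if "l \<le> n + m" "r \<le> 2 * s" for l r
      proof -
        have "real l * r \<le> real l * (2 * s)" using that(2) by (intro mult_left_mono) auto
        also have "\<dots> \<le> real (n + m) * (2 * s)" using that(1) s by (intro mult_right_mono) auto
        finally show ?thesis by (simp add: algebra_simps)
      qed
      show ?thesis
      proof (cases "f x \<le> g x")
        case True
        then have "f x + (\<Sum>k\<in>T. k x) \<le> 2 * s" using le bx by (simp add: s_def)
        then show ?thesis using T(3)[OF x] scale[of n] unfolding s_def by force
      next
        case False
        then have "g x + (\<Sum>k\<in>U. k x) \<le> 2 * s" using le bx by (simp add: s_def)
        then show ?thesis using U(3)[OF x] scale[of m] unfolding s_def by force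
      qed
    qed
    then have "a \<in> M" by (rule ideal_dominated[OF M(1) W a])
    then show False using M(2) by blast
  qed
qed

lemma prime_ideal_separation:
  assumes I: "mv_ideal (free_mv X) I" and a: "a \<in> mcnaughton X" "a \<notin> I"
  obtains P where "mv_prime_ideal (free_mv X) P" "I \<subseteq> P" "a \<notin> P"
proof -
  define \<A> where "\<A> = {J. mv_ideal (free_mv X) J \<and> I \<subseteq> J \<and> a \<notin> J}"
  have "\<exists>M\<in>\<A>. \<forall>J\<in>\<A>. M \<subseteq> J \<longrightarrow> J = M"
  proof (rule subset_Zorn_nonempty)
    show "\<A> \<noteq> {}" using I a unfolding \<A>_def by blast
    fix \<C> assume \<C>: "\<C> \<noteq> {}" "subset.chain \<A> \<C>"
    then have "mv_ideal (free_mv X) (\<Union>\<C>)"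
      by (intro mv_ideal_Union_chain) (auto simp: subset_chain_def \<A>_def)
    moreover have "\<C> \<subseteq> \<A>" using \<C>(2) by (simp add: subset_chain_def)
    then have "I \<subseteq> \<Union>\<C>" "a \<notin> \<Union>\<C>"
      using \<C>(1) unfolding \<A>_def by blast+
    ultimately show "\<Union>\<C> \<in> \<A>" unfolding \<A>_def by blast
  qed
  then obtain M where M: "M \<in> \<A>" "\<And>J. J \<in> \<A> \<Longrightarrow> M \<subseteq> J \<Longrightarrow> J = M" by blast
  have "mv_prime_ideal (free_mv X) M"
    using M a(1) unfolding \<A>_def by (intro maximal_avoiding_ideal_prime[of X M a]) auto
  then show ?thesis using that M(1) unfolding \<A>_def by blast
qed

text \<open>These ideals map the cube into the spectrum, and \<open>point_ideal X x\<close> lies in the basic open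
  set of \<open>a\<close> iff \<open>a x \<noteq> 0\<close>: zero sets are traces of closed sets of the spectrum.\<close>

definition point_ideal :: "'k set \<Rightarrow> ('k \<Rightarrow> real) \<Rightarrow> (('k \<Rightarrow> real) \<Rightarrow> real) set" where
  "point_ideal X x = {f \<in> mcnaughton X. f x = 0}"

lemma mv_prime_ideal_point_ideal:
  assumes x: "x \<in> cube X"
  shows "mv_prime_ideal (free_mv X) (point_ideal X x)"
  unfolding mv_prime_ideal_free_mv mv_ideal_free_mv
proof (intro conjI ballI impI)
  show "point_ideal X x \<subseteq> mcnaughton X" by (auto simp: point_ideal_def)
  have "(\<lambda>x\<in>cube X. 0) \<in> point_ideal X x" using x mcnaughton_zero by (simp add: point_ideal_def)
  then show "point_ideal X x \<noteq> {}" by blast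
  have "(\<lambda>x\<in>cube X. 1) \<notin> point_ideal X x" using x by (simp add: point_ideal_def)
  then show "point_ideal X x \<noteq> mcnaughton X" using mcnaughton_one by blast
next
  fix f g assume "f \<in> mcnaughton X" "g \<in> point_ideal X x" "\<forall>x\<in>cube X. f x \<le> g x"
  then show "f \<in> point_ideal X x"
    using x mcnaughton_bounds(1)[of f X x] by (force simp: point_ideal_def)
next
  fix f g assume "f \<in> point_ideal X x" "g \<in> point_ideal X x"
  then show "(\<lambda>x\<in>cube X. min 1 (f x + g x)) \<in> point_ideal X x"
    using x mcnaughton_add by (auto simp: point_ideal_def)
next
  fix f g assume "f \<in> mcnaughton X" "g \<in> mcnaughton X" "(\<lambda>x\<in>cube X. min (f x) (g x)) \<in> point_ideal X x"
  then show "f \<in> point_ideal X x \<or> g \<in> point_ideal X x"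
    using x by (auto simp: point_ideal_def min_def split: if_splits)
qed

section \<open>The prime spectrum is spectral\<close>

lemma mem_Spec_open [simp]: "P \<in> mv_Spec_open A a \<longleftrightarrow> mv_prime_ideal A P \<and> a \<notin> P"
  by (simp add: mv_Spec_open_def)

lemma prime_ideal_ideal: "mv_prime_ideal A P \<Longrightarrow> mv_ideal A P"
  by (simp add: mv_prime_ideal_def)

lemma Spec_open_min:
  assumes "f \<in> mcnaughton X" "g \<in> mcnaughton X"
  shows "mv_Spec_open (free_mv X) (\<lambda>x\<in>cube X. min (f x) (g x)) =
    mv_Spec_open (free_mv X) f \<inter> mv_Spec_open (free_mv X) g"
proof -
  have "(\<lambda>x\<in>cube X. min (f x) (g x)) \<in> P \<longleftrightarrow> f \<in> P \<or> g \<in> P" if P: "mv_prime_ideal (free_mv X) P" for P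
  proof
    assume "(\<lambda>x\<in>cube X. min (f x) (g x)) \<in> P"
    then show "f \<in> P \<or> g \<in> P" using P assms unfolding mv_prime_ideal_free_mv by blast
  next
    assume "f \<in> P \<or> g \<in> P"
    then show "(\<lambda>x\<in>cube X. min (f x) (g x)) \<in> P"
      by (elim disjE ideal_down[OF prime_ideal_ideal[OF P] _ mcnaughton_min[OF assms]]) auto
  qed
  then show ?thesis by auto
qed

lemma Spec_open_sum:
  assumes T: "finite T" "T \<subseteq> mcnaughton X"
  shows "mv_Spec_open (free_mv X) (\<lambda>x\<in>cube X. min 1 (\<Sum>f\<in>T. f x)) = (\<Union>f\<in>T. mv_Spec_open (free_mv X) f)"
proof -
  have "(\<lambda>x\<in>cube X. min 1 (\<Sum>f\<in>T. f x)) \<in> P \<longleftrightarrow> T \<subseteq> P" if P: "mv_prime_ideal (free_mv X) P" for P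
  proof
    assume *: "(\<lambda>x\<in>cube X. min 1 (\<Sum>f\<in>T. f x)) \<in> P"
    show "T \<subseteq> P"
    proof
      fix f assume f: "f \<in> T"
      then have fX: "f \<in> mcnaughton X" using T(2) by blast
      show "f \<in> P"
      proof (rule ideal_down[OF prime_ideal_ideal[OF P] * fX])
        fix x assume x: "x \<in> cube X"
        have "f x \<le> (\<Sum>f\<in>T. f x)"
          using T f x mcnaughton_bounds(1) by (intro member_le_sum) auto
        then show "f x \<le> (\<lambda>x\<in>cube X. min 1 (\<Sum>f\<in>T. f x)) x"
          using x mcnaughton_bounds(2)[OF fX x] by simp
      qed
    qed
  qed (use ideal_truncated_sum[OF prime_ideal_ideal[OF P] T(1)] in blast)
  then show ?thesis by auto
qed

lemma openin_Spec_basic: "a \<in> mcnaughton X \<Longrightarrow> openin (mv_Spec (free_mv X)) (mv_Spec_open (free_mv X) a)"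
  unfolding mv_Spec_def by (intro topology_generated_by_Basis) simp

lemma openin_Spec_iff:
  "openin (mv_Spec (free_mv X)) U \<longleftrightarrow> (\<exists>S\<subseteq>mcnaughton X. U = (\<Union>a\<in>S. mv_Spec_open (free_mv X) a))"
proof
  assume "openin (mv_Spec (free_mv X)) U"
  then have "generate_topology_on (mv_Spec_open (free_mv X) ` mcnaughton X) U"
    unfolding mv_Spec_def openin_topology_generated_by_iff by simp
  then show "\<exists>S\<subseteq>mcnaughton X. U = (\<Union>a\<in>S. mv_Spec_open (free_mv X) a)"
  proof induction
    case Empty
    then show ?case by (intro exI[of _ "{}"]) simp
  next
    case (Int U V)
    then obtain S T where S: "S \<subseteq> mcnaughton X" "U = (\<Union>a\<in>S. mv_Spec_open (free_mv X) a)"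
      and T: "T \<subseteq> mcnaughton X" "V = (\<Union>a\<in>T. mv_Spec_open (free_mv X) a)" by blast
    let ?m = "\<lambda>(f, g). \<lambda>x\<in>cube X. min (f x) (g x)"
    have "U \<inter> V = (\<Union>f\<in>S. \<Union>g\<in>T. mv_Spec_open (free_mv X) f \<inter> mv_Spec_open (free_mv X) g)"
      unfolding S(2) T(2) by blast
    also have "\<dots> = (\<Union>f\<in>S. \<Union>g\<in>T. mv_Spec_open (free_mv X) (?m (f, g)))"
      using S(1) T(1) by (intro SUP_cong refl) (simp add: Spec_open_min subset_iff)
    also have "\<dots> = (\<Union>a\<in>?m ` (S \<times> T). mv_Spec_open (free_mv X) a)"
      by blast
    finally have "U \<inter> V = (\<Union>a\<in>?m ` (S \<times> T). mv_Spec_open (free_mv X) a)" .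
    moreover have "?m ` (S \<times> T) \<subseteq> mcnaughton X"
      using S(1) T(1) mcnaughton_min by fastforce
    ultimately show ?case by blast
  next
    case (UN K)
    then obtain S where S: "\<And>k. k \<in> K \<Longrightarrow> S k \<subseteq> mcnaughton X \<and> k = (\<Union>a\<in>S k. mv_Spec_open (free_mv X) a)"
      by metis
    have "\<Union>K = (\<Union>k\<in>K. \<Union>a\<in>S k. mv_Spec_open (free_mv X) a)"
      using SUP_cong[of K K "\<lambda>k. k" "\<lambda>k. \<Union>a\<in>S k. mv_Spec_open (free_mv X) a"] S by simp
    also have "\<dots> = (\<Union>a\<in>(\<Union>k\<in>K. S k). mv_Spec_open (free_mv X) a)" by blast
    finally show ?case
      using S by (intro exI[of _ "\<Union>k\<in>K. S k"]) blast
  next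
    case (Basis U)
    then obtain a where "a \<in> mcnaughton X" "U = mv_Spec_open (free_mv X) a" by blast
    then show ?case by (intro exI[of _ "{a}"]) simp
  qed
qed (auto intro!: openin_Union openin_Spec_basic)

text \<open>If the open sets of \<open>S\<close> cover that of \<open>a\<close>, no prime ideal contains \<open>S\<close> and omits \<open>a\<close>, so \<open>a\<close>
  belongs to the ideal generated by \<open>S\<close>; a witness for this mentions only finitely many members.\<close>

lemma Spec_open_finite_subcover:
  assumes a: "a \<in> mcnaughton X" and S: "S \<subseteq> mcnaughton X"
    and cover: "mv_Spec_open (free_mv X) a \<subseteq> (\<Union>b\<in>S. mv_Spec_open (free_mv X) b)"
  obtains T where "finite T" "T \<subseteq> S" "mv_Spec_open (free_mv X) a \<subseteq> (\<Union>b\<in>T. mv_Spec_open (free_mv X) b)"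
proof -
  have "a \<in> generated_ideal X S"
  proof (rule ccontr)
    assume "a \<notin> generated_ideal X S"
    then obtain P where P: "mv_prime_ideal (free_mv X) P" "generated_ideal X S \<subseteq> P" "a \<notin> P"
      using prime_ideal_separation[OF mv_ideal_generated_ideal[OF S] a] by blast
    then have "P \<in> mv_Spec_open (free_mv X) a" by simp
    then have "P \<in> (\<Union>b\<in>S. mv_Spec_open (free_mv X) b)" using cover by (rule rev_subsetD)
    then show False using P(2) generated_ideal_superset[OF S] by auto
  qed
  then obtain T and n :: nat where T: "finite T" "T \<subseteq> S" "\<forall>x\<in>cube X. a x \<le> real n * (\<Sum>g\<in>T. g x)"
    unfolding generated_ideal_def by blast
  have "a \<in> P" if "mv_prime_ideal (free_mv X) P" "T \<subseteq> P" for P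
    using ideal_dominated[OF prime_ideal_ideal[OF that(1)] T(1) that(2) a, of n] T(3) by blast
  then have "mv_Spec_open (free_mv X) a \<subseteq> (\<Union>b\<in>T. mv_Spec_open (free_mv X) b)"
    by (simp add: subset_iff) blast
  then show ?thesis using that T by blast
qed

lemma compactin_Spec_open:
  assumes a: "a \<in> mcnaughton X"
  shows "compactin (mv_Spec (free_mv X)) (mv_Spec_open (free_mv X) a)"
  unfolding compactin_def
proof (intro conjI allI impI)
  show "mv_Spec_open (free_mv X) a \<subseteq> topspace (mv_Spec (free_mv X))"
    by (auto simp: topspace_mv_Spec)
  fix \<U> assume \<U>: "(\<forall>U\<in>\<U>. openin (mv_Spec (free_mv X)) U) \<and> mv_Spec_open (free_mv X) a \<subseteq> \<Union>\<U>"
  define S where "S = {b \<in> mcnaughton X. \<exists>U\<in>\<U>. mv_Spec_open (free_mv X) b \<subseteq> U}"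
  have SX: "S \<subseteq> mcnaughton X" by (auto simp: S_def)
  have cover: "mv_Spec_open (free_mv X) a \<subseteq> (\<Union>b\<in>S. mv_Spec_open (free_mv X) b)"
  proof
    fix P assume "P \<in> mv_Spec_open (free_mv X) a"
    then obtain U where U: "U \<in> \<U>" "P \<in> U" using \<U> by blast
    obtain B where B: "B \<subseteq> mcnaughton X" "U = (\<Union>b\<in>B. mv_Spec_open (free_mv X) b)"
      using \<U> U(1) openin_Spec_iff by metis
    then obtain b where b: "b \<in> B" "P \<in> mv_Spec_open (free_mv X) b" using U(2) unfolding B(2) by (elim UN_E)
    have "mv_Spec_open (free_mv X) b \<subseteq> U" unfolding B(2) using b(1) by (rule UN_upper)
    then have "b \<in> S" using b(1) B(1) U(1) unfolding S_def by (intro CollectI conjI bexI[of _ U]) auto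
    then show "P \<in> (\<Union>b\<in>S. mv_Spec_open (free_mv X) b)" using b(2) by auto
  qed
  obtain T where T: "finite T" "T \<subseteq> S" "mv_Spec_open (free_mv X) a \<subseteq> (\<Union>b\<in>T. mv_Spec_open (free_mv X) b)"
    by (rule Spec_open_finite_subcover[OF a SX cover])
  have "\<exists>U. U \<in> \<U> \<and> mv_Spec_open (free_mv X) b \<subseteq> U" if "b \<in> T" for b
    using T(2) that unfolding S_def by blast
  then obtain U where U: "\<forall>b\<in>T. U b \<in> \<U> \<and> mv_Spec_open (free_mv X) b \<subseteq> U b"
    using bchoice[of T "\<lambda>b U. U \<in> \<U> \<and> mv_Spec_open (free_mv X) b \<subseteq> U"] by blast
  have "(\<Union>b\<in>T. mv_Spec_open (free_mv X) b) \<subseteq> \<Union>(U ` T)"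
    using U by (intro UN_mono) auto
  then have "mv_Spec_open (free_mv X) a \<subseteq> \<Union>(U ` T)"
    using T(3) by (rule order_trans[rotated])
  moreover have "finite (U ` T)" "U ` T \<subseteq> \<U>" using T(1) U by auto
  ultimately show "\<exists>\<F>. finite \<F> \<and> \<F> \<subseteq> \<U> \<and> mv_Spec_open (free_mv X) a \<subseteq> \<Union>\<F>"
    by blast
qed

lemma compact_opens_Spec:
  "compact_opens (mv_Spec (free_mv X)) = mv_Spec_open (free_mv X) ` mcnaughton X"
proof
  show "mv_Spec_open (free_mv X) ` mcnaughton X \<subseteq> compact_opens (mv_Spec (free_mv X))"
    using openin_Spec_basic compactin_Spec_open unfolding compact_opens_def by blast
  show "compact_opens (mv_Spec (free_mv X)) \<subseteq> mv_Spec_open (free_mv X) ` mcnaughton X"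
  proof
    fix U assume "U \<in> compact_opens (mv_Spec (free_mv X))"
    then have U: "openin (mv_Spec (free_mv X)) U" "compactin (mv_Spec (free_mv X)) U"
      unfolding compact_opens_def by auto
    obtain S where S: "S \<subseteq> mcnaughton X" "U = \<Union>(mv_Spec_open (free_mv X) ` S)"
      using U(1) openin_Spec_iff by metis
    have "\<exists>\<F>. finite \<F> \<and> \<F> \<subseteq> mv_Spec_open (free_mv X) ` S \<and> U \<subseteq> \<Union>\<F>"
      using S U(2) openin_Spec_basic by (intro compactinD[OF U(2)]) auto
    then obtain T where T: "finite T" "T \<subseteq> S" "U \<subseteq> \<Union>(mv_Spec_open (free_mv X) ` T)"
      by (metis finite_subset_image)
    then have "U = \<Union>(mv_Spec_open (free_mv X) ` T)" using S(2) by blast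
    also have "\<dots> = mv_Spec_open (free_mv X) (\<lambda>x\<in>cube X. min 1 (\<Sum>f\<in>T. f x))"
      using Spec_open_sum T(1,2) S(1) by (metis subset_trans)
    finally show "U \<in> mv_Spec_open (free_mv X) ` mcnaughton X"
      using ideal_truncated_sum[OF mv_ideal_mcnaughton T(1)] T(2) S(1) by blast
  qed
qed

lemma topspace_Spec_open: "topspace (mv_Spec (free_mv X)) = mv_Spec_open (free_mv X) (\<lambda>x\<in>cube X. 1)"
proof -
  have "(\<lambda>x\<in>cube X. 1) \<notin> P" if "mv_prime_ideal (free_mv X) P" for P
  proof
    assume "(\<lambda>x\<in>cube X. 1) \<in> P"
    then have "mcnaughton X \<subseteq> P"
      using ideal_down[OF prime_ideal_ideal[OF that]] mcnaughton_bounds(2) by fastforce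
    then show False
      using that ideal_subset[OF prime_ideal_ideal[OF that]] unfolding mv_prime_ideal_free_mv by blast
  qed
  then show ?thesis by (auto simp: topspace_mv_Spec)
qed

lemma Spec_closure_of_point:
  assumes P: "mv_prime_ideal (free_mv X) P"
  shows "mv_Spec (free_mv X) closure_of {P} = {Q. mv_prime_ideal (free_mv X) Q \<and> P \<subseteq> Q}"
proof
  show "mv_Spec (free_mv X) closure_of {P} \<subseteq> {Q. mv_prime_ideal (free_mv X) Q \<and> P \<subseteq> Q}"
  proof
    fix Q assume Q: "Q \<in> mv_Spec (free_mv X) closure_of {P}"
    then have prime: "mv_prime_ideal (free_mv X) Q"
      by (auto simp: in_closure_of topspace_mv_Spec)
    have "a \<in> Q" if "a \<in> P" for a
    proof (rule ccontr)
      assume "a \<notin> Q"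
      then have "Q \<in> mv_Spec_open (free_mv X) a" using prime by simp
      moreover have "openin (mv_Spec (free_mv X)) (mv_Spec_open (free_mv X) a)"
        using that ideal_subset[OF prime_ideal_ideal[OF P]] openin_Spec_basic by blast
      ultimately have "P \<in> mv_Spec_open (free_mv X) a"
        using Q unfolding in_closure_of by blast
      then show False using that by simp
    qed
    then show "Q \<in> {Q. mv_prime_ideal (free_mv X) Q \<and> P \<subseteq> Q}" using prime by blast
  qed
  show "{Q. mv_prime_ideal (free_mv X) Q \<and> P \<subseteq> Q} \<subseteq> mv_Spec (free_mv X) closure_of {P}"
  proof
    fix Q assume "Q \<in> {Q. mv_prime_ideal (free_mv X) Q \<and> P \<subseteq> Q}"
    then have Q: "mv_prime_ideal (free_mv X) Q" "P \<subseteq> Q" by auto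
    have "P \<in> U" if U: "Q \<in> U" "openin (mv_Spec (free_mv X)) U" for U
    proof -
      obtain S where "U = (\<Union>a\<in>S. mv_Spec_open (free_mv X) a)"
        using U(2) openin_Spec_iff by metis
      then show ?thesis using U(1) Q(2) P by auto
    qed
    then show "Q \<in> mv_Spec (free_mv X) closure_of {P}"
      using Q(1) by (auto simp: in_closure_of topspace_mv_Spec)
  qed
qed

text \<open>If \<open>min f g\<close> lies in every member of \<open>C\<close>, each member contains \<open>f\<close> or \<open>g\<close>. Thus \<open>C\<close> is the
  union of two closed subsets, and irreducibility makes one of them all of \<open>C\<close>.\<close>

lemma mv_prime_ideal_Inter_irreducible:
  assumes C: "irreducible_closedin (mv_Spec (free_mv X)) C"
  shows "mv_prime_ideal (free_mv X) (\<Inter>C)"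
proof -
  have closed: "closedin (mv_Spec (free_mv X)) C" and "C \<noteq> {}"
    and irr: "\<And>D E. closedin (mv_Spec (free_mv X)) D \<Longrightarrow> closedin (mv_Spec (free_mv X)) E \<Longrightarrow> C = D \<union> E \<Longrightarrow> C = D \<or> C = E"
    using C unfolding irreducible_closedin_def by auto
  have prime: "mv_prime_ideal (free_mv X) P" if "P \<in> C" for P
    using closedin_subset[OF closed] that by (auto simp: topspace_mv_Spec)
  note ideal = prime_ideal_ideal[OF prime]
  obtain P where P: "P \<in> C" using \<open>C \<noteq> {}\<close> by blast
  have "mv_ideal (free_mv X) (\<Inter>C)"
    unfolding mv_ideal_free_mv
  proof (intro conjI ballI impI)
    show "\<Inter>C \<subseteq> mcnaughton X" using P ideal_subset[OF ideal[OF P]] by blast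
    show "\<Inter>C \<noteq> {}" using ideal_zero[OF ideal] by blast
  next
    fix f g assume "f \<in> mcnaughton X" "g \<in> \<Inter>C" "\<forall>x\<in>cube X. f x \<le> g x"
    then show "f \<in> \<Inter>C" using ideal_down[OF ideal] by blast
  next
    fix f g assume "f \<in> \<Inter>C" "g \<in> \<Inter>C"
    then show "(\<lambda>x\<in>cube X. min 1 (f x + g x)) \<in> \<Inter>C" using ideal_add[OF ideal] by blast
  qed
  moreover have "\<Inter>C \<noteq> mcnaughton X"
  proof
    assume "\<Inter>C = mcnaughton X"
    then have "P = mcnaughton X" using P ideal_subset[OF ideal[OF P]] by blast
    then show False using prime[OF P] unfolding mv_prime_ideal_free_mv by blast
  qed
  moreover have "f \<in> \<Inter>C \<or> g \<in> \<Inter>C"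
    if f: "f \<in> mcnaughton X" and g: "g \<in> mcnaughton X"
      and m: "(\<lambda>x\<in>cube X. min (f x) (g x)) \<in> \<Inter>C" for f g
  proof -
    have "P \<notin> mv_Spec_open (free_mv X) f \<or> P \<notin> mv_Spec_open (free_mv X) g" if "P \<in> C" for P
      using prime[OF that] m f g that unfolding mv_prime_ideal_free_mv by auto
    then have "C = (C - mv_Spec_open (free_mv X) f) \<union> (C - mv_Spec_open (free_mv X) g)"
      by blast
    then have "C = C - mv_Spec_open (free_mv X) f \<or> C = C - mv_Spec_open (free_mv X) g"
      by (intro irr closedin_diff closed openin_Spec_basic f g)
    moreover have "h \<in> \<Inter>C" if h: "C = C - mv_Spec_open (free_mv X) h" for h
    proof
      fix Q assume Q: "Q \<in> C"
      then have "Q \<in> C - mv_Spec_open (free_mv X) h" using equalityD1[OF h] by (rule rev_subsetD)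
      then have "Q \<notin> mv_Spec_open (free_mv X) h" by blast
      then show "h \<in> Q" using prime[OF Q] by simp
    qed
    ultimately show ?thesis by blast
  qed
  ultimately show ?thesis unfolding mv_prime_ideal_free_mv by blast
qed

lemma sober_space_Spec: "sober_space (mv_Spec (free_mv X))"
  unfolding sober_space_def
proof (intro allI impI)
  fix C assume C: "irreducible_closedin (mv_Spec (free_mv X)) C"
  then have closed: "closedin (mv_Spec (free_mv X)) C" unfolding irreducible_closedin_def by blast
  have prime: "mv_prime_ideal (free_mv X) (\<Inter>C)" by (rule mv_prime_ideal_Inter_irreducible[OF C])
  obtain S where S: "topspace (mv_Spec (free_mv X)) - C = (\<Union>a\<in>S. mv_Spec_open (free_mv X) a)"
    using closed openin_Spec_iff unfolding closedin_def by metis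
  have mem: "P \<in> C \<longleftrightarrow> mv_prime_ideal (free_mv X) P \<and> S \<subseteq> P" for P
  proof -
    have "P \<in> C \<longleftrightarrow> P \<in> topspace (mv_Spec (free_mv X)) \<and> P \<notin> topspace (mv_Spec (free_mv X)) - C"
      using closedin_subset[OF closed] by blast
    then show ?thesis unfolding S by (auto simp: topspace_mv_Spec)
  qed
  have "C = {Q. mv_prime_ideal (free_mv X) Q \<and> \<Inter>C \<subseteq> Q}"
  proof
    show "C \<subseteq> {Q. mv_prime_ideal (free_mv X) Q \<and> \<Inter>C \<subseteq> Q}" using mem by blast
    have "S \<subseteq> \<Inter>C" using mem by blast
    then show "{Q. mv_prime_ideal (free_mv X) Q \<and> \<Inter>C \<subseteq> Q} \<subseteq> C" using mem by blast
  qed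
  then have ex: "C = mv_Spec (free_mv X) closure_of {\<Inter>C}"
    unfolding Spec_closure_of_point[OF prime] .
  show "\<exists>!P. P \<in> topspace (mv_Spec (free_mv X)) \<and> C = mv_Spec (free_mv X) closure_of {P}"
  proof (rule ex1I[of _ "\<Inter>C"])
    show "\<Inter>C \<in> topspace (mv_Spec (free_mv X)) \<and> C = mv_Spec (free_mv X) closure_of {\<Inter>C}"
      using ex prime by (simp add: topspace_mv_Spec)
    fix P assume "P \<in> topspace (mv_Spec (free_mv X)) \<and> C = mv_Spec (free_mv X) closure_of {P}"
    then have P: "mv_prime_ideal (free_mv X) P" "C = {Q. mv_prime_ideal (free_mv X) Q \<and> P \<subseteq> Q}"
      using Spec_closure_of_point[of X P] by (auto simp: topspace_mv_Spec)
    then show "P = \<Inter>C" by blast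
  qed
qed

lemma spectral_space_Spec: "spectral_space (mv_Spec (free_mv X))"
  unfolding spectral_space_def
proof (intro conjI allI impI ballI)
  show "sober_space (mv_Spec (free_mv X))" by (rule sober_space_Spec)
  show "compact_space (mv_Spec (free_mv X))"
    unfolding compact_space_def topspace_Spec_open by (rule compactin_Spec_open[OF mcnaughton_one])
next
  fix U assume "openin (mv_Spec (free_mv X)) U"
  then obtain S where "S \<subseteq> mcnaughton X" "U = (\<Union>a\<in>S. mv_Spec_open (free_mv X) a)"
    using openin_Spec_iff by metis
  then show "\<exists>\<B>\<subseteq>compact_opens (mv_Spec (free_mv X)). U = \<Union>\<B>"
    unfolding compact_opens_Spec by (intro exI[of _ "mv_Spec_open (free_mv X) ` S"] conjI image_mono)
next
  fix U V assume "U \<in> compact_opens (mv_Spec (free_mv X))" "V \<in> compact_opens (mv_Spec (free_mv X))"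
  then obtain f g where fg: "f \<in> mcnaughton X" "g \<in> mcnaughton X"
    "U = mv_Spec_open (free_mv X) f" "V = mv_Spec_open (free_mv X) g"
    unfolding compact_opens_Spec by blast
  show "U \<inter> V \<in> compact_opens (mv_Spec (free_mv X))"
    unfolding compact_opens_Spec fg(3,4) Spec_open_min[OF fg(1,2), symmetric]
    by (rule imageI[OF mcnaughton_min[OF fg(1,2)]])
qed

section \<open>The anti-isomorphism\<close>

text \<open>The point ideals show that the inclusion of open sets forces the reverse inclusion of zero
  sets. The other direction is the Nullstellensatz: if \<open>a \<le> n b\<close>, every prime ideal
  containing \<open>b\<close> contains \<open>a\<close>.\<close>

lemma Spec_open_subset_iff:
  assumes a: "a \<in> mcnaughton X" and b: "b \<in> mcnaughton X"
  shows "mv_Spec_open (free_mv X) a \<subseteq> mv_Spec_open (free_mv X) b \<longleftrightarrow> zero_set X b \<subseteq> zero_set X a"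
proof
  assume sub: "mv_Spec_open (free_mv X) a \<subseteq> mv_Spec_open (free_mv X) b"
  show "zero_set X b \<subseteq> zero_set X a"
  proof
    fix x assume x: "x \<in> zero_set X b"
    then have "point_ideal X x \<notin> mv_Spec_open (free_mv X) b" "mv_prime_ideal (free_mv X) (point_ideal X x)"
      using b mv_prime_ideal_point_ideal by (auto simp: point_ideal_def zero_set_def)
    then have "a \<in> point_ideal X x" using sub by auto
    then show "x \<in> zero_set X a" using x by (simp add: point_ideal_def zero_set_def)
  qed
next
  assume "zero_set X b \<subseteq> zero_set X a"
  then obtain n :: nat where n: "\<forall>x\<in>cube X. a x \<le> n * b x"
    using mcnaughton_dominated[OF a b] by blast
  have "a \<in> P" if "mv_prime_ideal (free_mv X) P" "b \<in> P" for P
    using ideal_dominated[OF prime_ideal_ideal[OF that(1)], of "{b}" a n] that(2) a n by simp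
  then show "mv_Spec_open (free_mv X) a \<subseteq> mv_Spec_open (free_mv X) b" by auto
qed

lemma inclusion_order_lattice:
  assumes Un: "\<And>A B. A \<in> \<F> \<Longrightarrow> B \<in> \<F> \<Longrightarrow> A \<union> B \<in> \<F>"
    and Int: "\<And>A B. A \<in> \<F> \<Longrightarrow> B \<in> \<F> \<Longrightarrow> A \<inter> B \<in> \<F>"
  shows "lattice (inclusion_order \<F>)"
    and "A \<in> \<F> \<Longrightarrow> B \<in> \<F> \<Longrightarrow> A \<squnion>\<^bsub>inclusion_order \<F>\<^esub> B = A \<union> B"
    and "A \<in> \<F> \<Longrightarrow> B \<in> \<F> \<Longrightarrow> A \<sqinter>\<^bsub>inclusion_order \<F>\<^esub> B = A \<inter> B"
proof -
  interpret partial_order "inclusion_order \<F>"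
    by unfold_locales (auto simp: inclusion_order_def)
  have sup: "least (inclusion_order \<F>) (A \<union> B) (Upper (inclusion_order \<F>) {A, B})"
    if "A \<in> \<F>" "B \<in> \<F>" for A B
    using that Un[OF that] by (auto simp: least_def Upper_def inclusion_order_def)
  have inf: "greatest (inclusion_order \<F>) (A \<inter> B) (Lower (inclusion_order \<F>) {A, B})"
    if "A \<in> \<F>" "B \<in> \<F>" for A B
    using that Int[OF that] by (auto simp: greatest_def Lower_def inclusion_order_def)
  show "lattice (inclusion_order \<F>)"
  proof unfold_locales
    fix A B assume "A \<in> carrier (inclusion_order \<F>)" "B \<in> carrier (inclusion_order \<F>)"
    then have AB: "A \<in> \<F>" "B \<in> \<F>" by (auto simp: inclusion_order_def)
    show "\<exists>C. least (inclusion_order \<F>) C (Upper (inclusion_order \<F>) {A, B})"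
      using sup[OF AB] by blast
    show "\<exists>C. greatest (inclusion_order \<F>) C (Lower (inclusion_order \<F>) {A, B})"
      using inf[OF AB] by blast
  qed
  show "A \<squnion>\<^bsub>inclusion_order \<F>\<^esub> B = A \<union> B" if "A \<in> \<F>" "B \<in> \<F>"
    unfolding join_def Lattice.sup_def using sup[OF that] by (metis least_unique someI)
  show "A \<sqinter>\<^bsub>inclusion_order \<F>\<^esub> B = A \<inter> B" if "A \<in> \<F>" "B \<in> \<F>"
    unfolding meet_def Lattice.inf_def using inf[OF that] by (metis greatest_unique someI)
qed

text \<open>Defining the map on arbitrary sets \<open>U\<close> of prime ideals, as the points of the cube whose ideal is
  not in \<open>U\<close>, avoids choosing a function \<open>a\<close> that represents \<open>U\<close>, and makes it evident
  that unions and intersections are exchanged.\<close>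

definition spec_polyhedron ::
    "'k set \<Rightarrow> (('k \<Rightarrow> real) \<Rightarrow> real) set set \<Rightarrow> ('k \<Rightarrow> real) set" where
  "spec_polyhedron X U = {x \<in> cube X. point_ideal X x \<notin> U}"

lemma spec_polyhedron_Spec_open:
  assumes "a \<in> mcnaughton X"
  shows "spec_polyhedron X (mv_Spec_open (free_mv X) a) = zero_set X a"
  using assms mv_prime_ideal_point_ideal
  by (auto simp: spec_polyhedron_def zero_set_def point_ideal_def)

theorem theorem3p8:
  fixes X :: "'k set"
  shows "spectral_space (mv_Spec (free_mv X)) \<and>
    (\<exists>\<phi>. lattice_anti_isomorphism
           (inclusion_order (compact_opens (mv_Spec (free_mv X))))
           (inclusion_order (cylinder_rational_polyhedra X)) \<phi>)"
proof
  show "spectral_space (mv_Spec (free_mv X))" by (rule spectral_space_Spec)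
  let ?K = "compact_opens (mv_Spec (free_mv X))" and ?C = "cylinder_rational_polyhedra X"
  let ?O = "mv_Spec_open (free_mv X)"
  have K_Int: "U \<inter> V \<in> ?K" if "U \<in> ?K" "V \<in> ?K" for U V
    using that spectral_space_Spec unfolding spectral_space_def by blast
  have K_Un: "U \<union> V \<in> ?K" if "U \<in> ?K" "V \<in> ?K" for U V
    using that unfolding compact_opens_def by (auto intro: compactin_Un)
  have C: "P \<inter> Q \<in> ?C \<and> P \<union> Q \<in> ?C" if PQ: "P \<in> ?C" "Q \<in> ?C" for P Q
  proof -
    obtain f g where fg: "f \<in> mcnaughton X" "g \<in> mcnaughton X" "P = zero_set X f" "Q = zero_set X g"
      using PQ unfolding cylinder_rational_polyhedra_eq by blast
    show ?thesis
      unfolding cylinder_rational_polyhedra_eq fg(3,4)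
        zero_set_add[OF fg(1,2), symmetric] zero_set_min[OF fg(1,2), symmetric]
      by (intro conjI imageI mcnaughton_add mcnaughton_min fg)
  qed
  then have C_Int: "P \<inter> Q \<in> ?C" and C_Un: "P \<union> Q \<in> ?C" if "P \<in> ?C" "Q \<in> ?C" for P Q
    using that by blast+
  note K = inclusion_order_lattice[of ?K, OF K_Un K_Int]
  note C = inclusion_order_lattice[of ?C, OF C_Un C_Int]
  have bij: "bij_betw (spec_polyhedron X) ?K ?C"
  proof (rule bij_betwI')
    fix U V assume "U \<in> ?K" "V \<in> ?K"
    then obtain a b where ab: "a \<in> mcnaughton X" "b \<in> mcnaughton X" "U = ?O a" "V = ?O b"
      unfolding compact_opens_Spec by blast
    then show "spec_polyhedron X U = spec_polyhedron X V \<longleftrightarrow> U = V"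
      using Spec_open_subset_iff[OF ab(1,2)] Spec_open_subset_iff[OF ab(2,1)]
      by (auto simp: spec_polyhedron_Spec_open)
  next
    fix U assume "U \<in> ?K"
    then show "spec_polyhedron X U \<in> ?C"
      unfolding compact_opens_Spec cylinder_rational_polyhedra_eq by (auto simp: spec_polyhedron_Spec_open)
  next
    fix P assume "P \<in> ?C"
    then obtain a where "a \<in> mcnaughton X" "P = zero_set X a"
      unfolding cylinder_rational_polyhedra_eq by blast
    then show "\<exists>U\<in>?K. P = spec_polyhedron X U"
      unfolding compact_opens_Spec using spec_polyhedron_Spec_open by blast
  qed
  have "spec_polyhedron X (U \<union> V) = spec_polyhedron X U \<inter> spec_polyhedron X V"
    "spec_polyhedron X (U \<inter> V) = spec_polyhedron X U \<union> spec_polyhedron X V" for U V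
    by (auto simp: spec_polyhedron_def)
  then have "lattice_anti_isomorphism (inclusion_order ?K) (inclusion_order ?C) (spec_polyhedron X)"
    unfolding lattice_anti_isomorphism_def
    using K C bij bij_betwE[OF bij] by (simp add: inclusion_order_def)
  then show "\<exists>\<phi>. lattice_anti_isomorphism (inclusion_order ?K) (inclusion_order ?C) \<phi>" by blast
qed

end
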